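(* Every (sufficiently smooth) solution $F:[0,T)\times M\to\mathbb{R}^{n+1}$ of the hyperbolic mean curvature flow (HMCF) satisfies the conservation law $$\frac{d}{dt}\big(e\,d\mu\big)=d^\dagger\big((n-e)S\big)\,d\mu.$$ In particular, if the initial velocity is normal along the hypersurface, then $e\,d\mu$ is conserved along the flow, $$\frac{d}{dt}\big(e\,d\mu\big)=0,$$ so that $e\,d\mu$ is a fixed (time-independent) volume form on $M$.
   Context: $M$ is an orientable smooth $n$-dimensional manifold and $F:[0,T)\times M\to\mathbb{R}^{n+1}$ is a smooth family of immersions. $\frac{d}{dt}$ is the time derivative at a fixed point of $M$ (also applied to time-dependent $n$-forms on $M$); in local coordinates $F_i:=\partial F/\partial x^i$; $g_{ij}:=\langle F_i,F_j\rangle$ is the induced metric, with Levi-Civita connection $\nabla$ and (time-dependent) volume form $d\mu=d\mu_t$; indices are raised with $g^{ij}$. $\nu$ is the unit normal along the hypersurface (inward pointing when $M$ is compact without boundary), $h_{ij}:=-\langle F_i,\nabla_j\nu\rangle$, $H:=g^{ij}h_{ij}$. $\sigma:=\langle\frac{dF}{dt},\nu\rangle$, $S_i:=\langle\frac{dF}{dt},F_i\rangle$, $d^\dagger V:=\nabla^iV_i$ for a $1$-form $V$, $e:=\frac12\left(\left|\frac{dF}{dt}\right|^2+n\right)$. The equation (HMCF) is $$\frac{d^2}{dt^2}F=\big((e-|S|^2)H-\sigma\,d^\dagger S\big)\nu+\big((\sigma H-d^\dagger S)S^k-\nabla^ke\big)F_k.$$ The initial velocity is normal if $S=0$ at $t=0$.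 *)

theory Defs
  imports "HOL-Analysis.Analysis"
begin

section \<open>Maps of class \<open>C\<^sup>k\<close>\<close>

text \<open>
  Derivatives are taken within the domain \<open>A\<close>.  This is meant for sets such as open subsets of
  Euclidean space or \<open>[0,T) \<times> U\<close> with \<open>U\<close> open, where derivatives within the set are unique; at the
  boundary \<open>t = 0\<close> the derivatives are one-sided.
\<close>

primrec Ck_on :: "nat \<Rightarrow> 'a set \<Rightarrow> ('a::real_normed_vector \<Rightarrow> 'b::real_normed_vector) \<Rightarrow> bool" where
  "Ck_on 0 A f \<longleftrightarrow> continuous_on A f"
| "Ck_on (Suc k) A f \<longleftrightarrow>
     (\<exists>f'. (\<forall>x\<in>A. (f has_derivative f' x) (at x within A)) \<and> (\<forall>v. Ck_on k A (\<lambda>x. f' x v)))"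

text \<open>Class \<open>C\<^sup>r\<close> with \<open>r \<in> {0, 1, 2, \<dots>, \<infinity>}\<close>; the case \<open>r = \<infinity>\<close> is smoothness.\<close>

definition class_C_on :: "enat \<Rightarrow> 'a set \<Rightarrow> ('a::real_normed_vector \<Rightarrow> 'b::real_normed_vector) \<Rightarrow> bool" where
  "class_C_on r A f \<longleftrightarrow> (\<forall>k. enat k \<le> r \<longrightarrow> Ck_on k A f)"

section \<open>Oriented smooth manifolds\<close>

text \<open>
  The manifold \<open>M\<close> is the whole of a Hausdorff, second countable type \<open>'m\<close>.  A chart is a pair of its
  domain and its coordinate map; the dimension is the cardinality of the index type \<open>'n\<close>.
\<close>

type_synonym ('m, 'n) chart = "'m set \<times> ('m \<Rightarrow> real ^ 'n)"

definition cdom :: "('m, 'n::finite) chart \<Rightarrow> 'm set" where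
  "cdom c = fst c"

definition coord :: "('m, 'n::finite) chart \<Rightarrow> 'm \<Rightarrow> real ^ 'n" where
  "coord c = snd c"

definition param :: "('m, 'n::finite) chart \<Rightarrow> real ^ 'n \<Rightarrow> 'm" where
  "param c = inv_into (cdom c) (coord c)"

definition is_chart :: "('m::topological_space, 'n::finite) chart \<Rightarrow> bool" where
  "is_chart c \<longleftrightarrow> open (cdom c) \<and> open (coord c ` cdom c) \<and>
     homeomorphism (cdom c) (coord c ` cdom c) (coord c) (param c)"

definition transition :: "('m, 'n::finite) chart \<Rightarrow> ('m, 'n) chart \<Rightarrow> real ^ 'n \<Rightarrow> real ^ 'n" where
  "transition c d = coord d \<circ> param c"

definition smooth_atlas :: "('m::topological_space, 'n::finite) chart set \<Rightarrow> bool" where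
  "smooth_atlas \<A> \<longleftrightarrow>
     (\<forall>c\<in>\<A>. is_chart c) \<and> (\<Union>c\<in>\<A>. cdom c) = UNIV \<and>
     (\<forall>c\<in>\<A>. \<forall>d\<in>\<A>. class_C_on \<infinity> (coord c ` (cdom c \<inter> cdom d)) (transition c d))"

definition oriented_atlas :: "('m::topological_space, 'n::finite) chart set \<Rightarrow> bool" where
  "oriented_atlas \<A> \<longleftrightarrow> smooth_atlas \<A> \<and>
     (\<forall>c\<in>\<A>. \<forall>d\<in>\<A>. \<forall>p\<in>cdom c \<inter> cdom d.
        0 < det (matrix (frechet_derivative (transition c d) (at (coord c p)))))"

text \<open>
  A tangent vector at \<open>p\<close> is a family of coordinate vectors, one for each chart around \<open>p\<close>, related by
  the Jacobians of the transition maps.  The components for all other pairs are set to \<open>0\<close>, so that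
  the tangent space is a vector space of dimension \<open>n\<close>.
\<close>

type_synonym ('m, 'n) tangent = "('m, 'n) chart \<Rightarrow> real ^ 'n"

definition tangent_space ::
    "('m::topological_space, 'n::finite) chart set \<Rightarrow> 'm \<Rightarrow> ('m, 'n) tangent set" where
  "tangent_space \<A> p =
     {X. (\<forall>c. \<not> (c \<in> \<A> \<and> p \<in> cdom c) \<longrightarrow> X c = 0) \<and>
         (\<forall>c\<in>\<A>. \<forall>d\<in>\<A>. p \<in> cdom c \<inter> cdom d \<longrightarrow>
            X d = frechet_derivative (transition c d) (at (coord c p)) (X c))}"

text \<open>
  An \<open>n\<close>-form assigns a real number to a point \<open>p\<close> and an \<open>n\<close>-tuple of tangent vectors at \<open>p\<close>.
  The form \<open>dx\<^sup>1 \<and> \<dots> \<and> dx\<^sup>n\<close> of a chart is the determinant of the coordinate vectors.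
\<close>

type_synonym ('m, 'n) nform = "'m \<Rightarrow> ('n \<Rightarrow> ('m, 'n) tangent) \<Rightarrow> real"

definition dx :: "('m, 'n::finite) chart \<Rightarrow> ('n \<Rightarrow> ('m, 'n) tangent) \<Rightarrow> real" where
  "dx c X = det (\<chi> i. X i c)"

text \<open>A volume form of class \<open>C\<^sup>r\<close>: a nowhere vanishing \<open>n\<close>-form with \<open>C\<^sup>r\<close> coefficients.\<close>

definition volume_form ::
    "enat \<Rightarrow> ('m::topological_space, 'n::finite) chart set \<Rightarrow> ('m, 'n) nform \<Rightarrow> bool" where
  "volume_form r \<A> \<omega> \<longleftrightarrow>
     (\<forall>c\<in>\<A>. \<exists>f. class_C_on r (coord c ` cdom c) f \<and> (\<forall>x\<in>coord c ` cdom c. f x \<noteq> 0) \<and>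
        (\<forall>p\<in>cdom c. \<forall>X. (\<forall>i. X i \<in> tangent_space \<A> p) \<longrightarrow> \<omega> p X = f (coord c p) * dx c X))"

section \<open>Derivatives in time and in local coordinates\<close>

text \<open>The time interval \<open>[0,T)\<close>, where \<open>T = \<infinity>\<close> is allowed.\<close>

definition time_interval :: "ereal \<Rightarrow> real set" where
  "time_interval T = {t. 0 \<le> t \<and> ereal t < T}"

definition time_deriv :: "ereal \<Rightarrow> (real \<Rightarrow> 'm \<Rightarrow> 'b::real_normed_vector) \<Rightarrow> real \<Rightarrow> 'm \<Rightarrow> 'b" where
  "time_deriv T f t p = vector_derivative (\<lambda>s. f s p) (at t within time_interval T)"

definition partial ::
    "('m, 'n::finite) chart \<Rightarrow> 'n \<Rightarrow> ('m \<Rightarrow> 'b::real_normed_vector) \<Rightarrow> 'm \<Rightarrow> 'b" where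
  "partial c i f p =
     vector_derivative (\<lambda>s. f (param c (coord c p + s *\<^sub>R axis i 1))) (at 0)"

definition class_C_family ::
    "enat \<Rightarrow> ereal \<Rightarrow> ('m::topological_space, 'n::finite) chart set
      \<Rightarrow> (real \<Rightarrow> 'm \<Rightarrow> 'b::real_normed_vector) \<Rightarrow> bool" where
  "class_C_family r T \<A> F \<longleftrightarrow>
     (\<forall>c\<in>\<A>. class_C_on r (time_interval T \<times> coord c ` cdom c) (\<lambda>(t, x). F t (param c x)))"

definition immersion ::
    "('m::topological_space, 'n::finite) chart set \<Rightarrow> ('m \<Rightarrow> 'b::real_normed_vector) \<Rightarrow> bool" where
  "immersion \<A> f \<longleftrightarrow>
     (\<forall>c\<in>\<A>. \<forall>p\<in>cdom c.
        (f \<circ> param c) differentiable (at (coord c p)) \<and>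
        inj (frechet_derivative (f \<circ> param c) (at (coord c p))))"

section \<open>Geometry of an evolving hypersurface\<close>

definition metric ::
    "('m, 'n::finite) chart \<Rightarrow> (real \<Rightarrow> 'm \<Rightarrow> real ^ 'd::finite) \<Rightarrow> real \<Rightarrow> 'm \<Rightarrow> real ^ 'n ^ 'n" where
  "metric c F t p = (\<chi> i j. partial c i (F t) p \<bullet> partial c j (F t) p)"

definition inv_metric ::
    "('m, 'n::finite) chart \<Rightarrow> (real \<Rightarrow> 'm \<Rightarrow> real ^ 'd::finite) \<Rightarrow> real \<Rightarrow> 'm \<Rightarrow> real ^ 'n ^ 'n" where
  "inv_metric c F t p = matrix_inv (metric c F t p)"

text \<open>The Christoffel symbol \<open>\<Gamma>\<^sup>k\<^sub>i\<^sub>j\<close> of the Levi-Civita connection.\<close>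

definition christoffel ::
    "('m, 'n::finite) chart \<Rightarrow> (real \<Rightarrow> 'm \<Rightarrow> real ^ 'd::finite) \<Rightarrow> real \<Rightarrow> 'n \<Rightarrow> 'n \<Rightarrow> 'n \<Rightarrow> 'm \<Rightarrow> real" where
  "christoffel c F t k i j p =
     (1 / 2) * (\<Sum>l\<in>UNIV. inv_metric c F t p $ k $ l *
       (partial c i (\<lambda>q. metric c F t q $ j $ l) p + partial c j (\<lambda>q. metric c F t q $ i $ l) p
        - partial c l (\<lambda>q. metric c F t q $ i $ j) p))"

text \<open>The component \<open>\<nabla>\<^sub>i V\<^sub>j\<close>; a 1-form is given by its components in the chart \<open>c\<close>.\<close>

definition cov_deriv ::
    "('m, 'n::finite) chart \<Rightarrow> (real \<Rightarrow> 'm \<Rightarrow> real ^ 'd::finite) \<Rightarrow> real \<Rightarrow> 'n \<Rightarrow> 'n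
      \<Rightarrow> ('m \<Rightarrow> real ^ 'n) \<Rightarrow> 'm \<Rightarrow> real" where
  "cov_deriv c F t i j V p =
     partial c i (\<lambda>q. V q $ j) p - (\<Sum>k\<in>UNIV. christoffel c F t k i j p * V p $ k)"

text \<open>\<open>d\<^sup>\<dagger>V = \<nabla>\<^sup>i V\<^sub>i\<close>\<close>

definition ddagger ::
    "('m, 'n::finite) chart \<Rightarrow> (real \<Rightarrow> 'm \<Rightarrow> real ^ 'd::finite) \<Rightarrow> real
      \<Rightarrow> ('m \<Rightarrow> real ^ 'n) \<Rightarrow> 'm \<Rightarrow> real" where
  "ddagger c F t V p =
     (\<Sum>i\<in>UNIV. \<Sum>j\<in>UNIV. inv_metric c F t p $ i $ j * cov_deriv c F t j i V p)"

text \<open>The component \<open>\<nabla>\<^sup>k u\<close> of the gradient of a function.\<close>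

definition grad_up ::
    "('m, 'n::finite) chart \<Rightarrow> (real \<Rightarrow> 'm \<Rightarrow> real ^ 'd::finite) \<Rightarrow> real \<Rightarrow> 'n \<Rightarrow> ('m \<Rightarrow> real) \<Rightarrow> 'm \<Rightarrow> real" where
  "grad_up c F t k u p = (\<Sum>i\<in>UNIV. inv_metric c F t p $ k $ i * partial c i u p)"

text \<open>
  A \<open>C\<^sup>1\<close> unit normal field along the family.  All notions below that involve the choice of sign
  (\<open>h\<close>, \<open>H\<close> and \<open>\<sigma>\<close>) enter the equation only in products invariant under \<open>\<nu> \<mapsto> -\<nu>\<close>, so no inward
  pointing convention is imposed.
\<close>

definition unit_normal_field ::
    "ereal \<Rightarrow> ('m::topological_space, 'n::finite) chart set
      \<Rightarrow> (real \<Rightarrow> 'm \<Rightarrow> real ^ 'd::finite) \<Rightarrow> (real \<Rightarrow> 'm \<Rightarrow> real ^ 'd) \<Rightarrow> bool" where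
  "unit_normal_field T \<A> F \<nu> \<longleftrightarrow> class_C_family 1 T \<A> \<nu> \<and>
     (\<forall>t\<in>time_interval T. \<forall>p. norm (\<nu> t p) = 1 \<and>
        (\<forall>c\<in>\<A>. p \<in> cdom c \<longrightarrow> (\<forall>i. \<nu> t p \<bullet> partial c i (F t) p = 0)))"

definition second_fundamental_form ::
    "('m, 'n::finite) chart \<Rightarrow> (real \<Rightarrow> 'm \<Rightarrow> real ^ 'd::finite) \<Rightarrow> (real \<Rightarrow> 'm \<Rightarrow> real ^ 'd)
      \<Rightarrow> real \<Rightarrow> 'm \<Rightarrow> real ^ 'n ^ 'n" where
  "second_fundamental_form c F \<nu> t p = (\<chi> i j. - (partial c i (F t) p \<bullet> partial c j (\<nu> t) p))"

definition mean_curvature ::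
    "('m, 'n::finite) chart \<Rightarrow> (real \<Rightarrow> 'm \<Rightarrow> real ^ 'd::finite) \<Rightarrow> (real \<Rightarrow> 'm \<Rightarrow> real ^ 'd)
      \<Rightarrow> real \<Rightarrow> 'm \<Rightarrow> real" where
  "mean_curvature c F \<nu> t p =
     (\<Sum>i\<in>UNIV. \<Sum>j\<in>UNIV. inv_metric c F t p $ i $ j * second_fundamental_form c F \<nu> t p $ i $ j)"

definition normal_speed ::
    "ereal \<Rightarrow> (real \<Rightarrow> 'm \<Rightarrow> real ^ 'd::finite) \<Rightarrow> (real \<Rightarrow> 'm \<Rightarrow> real ^ 'd) \<Rightarrow> real \<Rightarrow> 'm \<Rightarrow> real" where
  "normal_speed T F \<nu> t p = time_deriv T F t p \<bullet> \<nu> t p"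

text \<open>The components \<open>S\<^sub>i\<close>, then \<open>S\<^sup>k = g\<^sup>k\<^sup>i S\<^sub>i\<close> and \<open>|S|\<^sup>2 = g\<^sup>i\<^sup>j S\<^sub>i S\<^sub>j\<close>.\<close>

definition S_form ::
    "ereal \<Rightarrow> ('m, 'n::finite) chart \<Rightarrow> (real \<Rightarrow> 'm \<Rightarrow> real ^ 'd::finite) \<Rightarrow> real \<Rightarrow> 'm \<Rightarrow> real ^ 'n" where
  "S_form T c F t p = (\<chi> i. time_deriv T F t p \<bullet> partial c i (F t) p)"

definition S_up ::
    "ereal \<Rightarrow> ('m, 'n::finite) chart \<Rightarrow> (real \<Rightarrow> 'm \<Rightarrow> real ^ 'd::finite) \<Rightarrow> real \<Rightarrow> 'm \<Rightarrow> real ^ 'n" where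
  "S_up T c F t p = inv_metric c F t p *v S_form T c F t p"

definition S_norm_sq ::
    "ereal \<Rightarrow> ('m, 'n::finite) chart \<Rightarrow> (real \<Rightarrow> 'm \<Rightarrow> real ^ 'd::finite) \<Rightarrow> real \<Rightarrow> 'm \<Rightarrow> real" where
  "S_norm_sq T c F t p =
     (\<Sum>i\<in>UNIV. \<Sum>j\<in>UNIV. inv_metric c F t p $ i $ j * S_form T c F t p $ i * S_form T c F t p $ j)"

text \<open>The function \<open>e\<close>; the argument \<open>n\<close> is the dimension of \<open>M\<close>.\<close>

definition energy ::
    "ereal \<Rightarrow> nat \<Rightarrow> (real \<Rightarrow> 'm \<Rightarrow> real ^ 'd::finite) \<Rightarrow> real \<Rightarrow> 'm \<Rightarrow> real" where
  "energy T n F t p = (1 / 2) * ((norm (time_deriv T F t p))\<^sup>2 + real n)"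

definition HMCF ::
    "ereal \<Rightarrow> ('m::topological_space, 'n::finite) chart set
      \<Rightarrow> (real \<Rightarrow> 'm \<Rightarrow> real ^ 'd::finite) \<Rightarrow> (real \<Rightarrow> 'm \<Rightarrow> real ^ 'd) \<Rightarrow> bool" where
  "HMCF T \<A> F \<nu> \<longleftrightarrow>
     (\<forall>t\<in>time_interval T. \<forall>c\<in>\<A>. \<forall>p\<in>cdom c.
        let e = energy T CARD('n) F t;
            \<sigma> = normal_speed T F \<nu> t p;
            H = mean_curvature c F \<nu> t p;
            dS = ddagger c F t (S_form T c F t) p
        in time_deriv T (time_deriv T F) t p =
             ((e p - S_norm_sq T c F t p) * H - \<sigma> * dS) *\<^sub>R \<nu> t p +
             (\<Sum>k\<in>UNIV. ((\<sigma> * H - dS) * S_up T c F t p $ k - grad_up c F t k e p)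
                *\<^sub>R partial c k (F t) p))"

text \<open>
  The Riemannian volume form \<open>d\<mu>\<^sub>t\<close> of the induced metric: the \<open>n\<close>-form that in each of the charts of the
  oriented atlas is \<open>sqrt (det g) dx\<^sup>1 \<and> \<dots> \<and> dx\<^sup>n\<close>.
\<close>

definition dmu ::
    "('m::topological_space, 'n::finite) chart set \<Rightarrow> (real \<Rightarrow> 'm \<Rightarrow> real ^ 'd::finite)
      \<Rightarrow> real \<Rightarrow> ('m, 'n) nform" where
  "dmu \<A> F t p X =
     (THE y. \<forall>c\<in>\<A>. p \<in> cdom c \<longrightarrow> y = sqrt (det (metric c F t p)) * dx c X)"

text \<open>The time-dependent \<open>n\<close>-form \<open>e d\<mu>\<close>.\<close>

definition e_dmu ::
    "ereal \<Rightarrow> ('m::topological_space, 'n::finite) chart set \<Rightarrow> (real \<Rightarrow> 'm \<Rightarrow> real ^ 'd::finite)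
      \<Rightarrow> real \<Rightarrow> ('m, 'n) nform" where
  "e_dmu T \<A> F t p X = energy T CARD('n) F t p * dmu \<A> F t p X"

end

theory Submission
  imports Defs
begin

text \<open>
  In a chart, \<open>e d\<mu> = e \<surd>(det g) dx\<^sup>1 \<and> \<dots> \<and> dx\<^sup>n\<close>.  By Jacobi's formula and the Gauss formula,
  \<open>\<surd>(det g)\<close> has logarithmic time derivative \<open>g\<^sup>i\<^sup>j \<langle>\<partial>\<^sub>i (dF/dt), F\<^sub>j\<rangle> = d\<^sup>\<dagger>S - \<sigma>H\<close>, while pairing the equation
  with \<open>dF/dt = \<sigma>\<nu> + S\<^sup>k F\<^sub>k\<close> gives \<open>de/dt = \<sigma>eH - (2e - n) d\<^sup>\<dagger>S - S\<^sup>k \<partial>\<^sub>k e\<close>; the sum is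
  \<open>(n - e) d\<^sup>\<dagger>S - S\<^sup>k \<partial>\<^sub>k e = d\<^sup>\<dagger>((n - e) S)\<close>.  Pairing the equation with \<open>F\<^sub>i\<close> gives
  \<open>dS\<^sub>i/dt = (\<sigma>H - d\<^sup>\<dagger>S) S\<^sub>i\<close>, so \<open>\<surd>(det g) S\<^sub>i\<close> does not depend on time; hence \<open>S = 0\<close> is preserved,
  and then \<open>e d\<mu>\<close> is constant in time.
\<close>

section \<open>Maps of class \<open>C\<^sup>k\<close>\<close>

lemma Ck_on_SucE:
  assumes "Ck_on (Suc k) A f"
  obtains f' where "\<And>x. x \<in> A \<Longrightarrow> (f has_derivative f' x) (at x within A)"
    and "\<And>v. Ck_on k A (\<lambda>x. f' x v)"
  using assms by auto

lemma Ck_on_SucI: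
  assumes "\<And>x. x \<in> A \<Longrightarrow> (f has_derivative f' x) (at x within A)"
    and "\<And>v. Ck_on k A (\<lambda>x. f' x v)"
  shows "Ck_on (Suc k) A f"
  using assms by auto

declare Ck_on.simps(2) [simp del]

lemma Ck_on_SucD: "Ck_on (Suc k) A f \<Longrightarrow> Ck_on k A f"
proof (induction k arbitrary: f)
  case 0
  then show ?case
    by (auto elim!: Ck_on_SucE intro: has_derivative_continuous_on)
next
  case (Suc k)
  from Suc.prems obtain f' where "\<And>x. x \<in> A \<Longrightarrow> (f has_derivative f' x) (at x within A)"
    and "\<And>v. Ck_on (Suc k) A (\<lambda>x. f' x v)"
    by (rule Ck_on_SucE) blast
  then show ?case
    by (intro Ck_on_SucI[of A f f'] Suc.IH) auto
qed

lemma Ck_on_imp_continuous_on: "Ck_on k A f \<Longrightarrow> continuous_on A f"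
  by (induction k) (auto dest: Ck_on_SucD)

lemma Ck_on_cong:
  assumes "Ck_on k A f" and eq: "\<And>x. x \<in> A \<Longrightarrow> f x = g x"
  shows "Ck_on k A g"
proof (cases k)
  case 0
  then show ?thesis
    using assms by (simp cong: continuous_on_cong)
next
  case (Suc m)
  obtain f' where "\<And>x. x \<in> A \<Longrightarrow> (f has_derivative f' x) (at x within A)"
    and "\<And>v. Ck_on m A (\<lambda>x. f' x v)"
    using assms(1) unfolding Suc by (rule Ck_on_SucE) blast
  then show ?thesis
    unfolding Suc
    by (intro Ck_on_SucI[of A g f']) (auto intro: has_derivative_transform[where f = f] simp: eq)
qed

lemma Ck_on_const: "Ck_on k A (\<lambda>_. a)"
proof (induction k arbitrary: a)
  case (Suc k)
  then show ?case
    by (intro Ck_on_SucI[where f' = "\<lambda>_ _. 0"]) auto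
qed simp

lemma Ck_on_add:
  assumes "Ck_on k A f" "Ck_on k A g"
  shows "Ck_on k A (\<lambda>x. f x + g x)"
  using assms
proof (induction k arbitrary: f g)
  case (Suc k)
  obtain f' where f': "\<And>x. x \<in> A \<Longrightarrow> (f has_derivative f' x) (at x within A)"
    "\<And>v. Ck_on k A (\<lambda>x. f' x v)"
    using Suc.prems(1) by (rule Ck_on_SucE) blast
  obtain g' where g': "\<And>x. x \<in> A \<Longrightarrow> (g has_derivative g' x) (at x within A)"
    "\<And>v. Ck_on k A (\<lambda>x. g' x v)"
    using Suc.prems(2) by (rule Ck_on_SucE) blast
  show ?case
    by (rule Ck_on_SucI[where f' = "\<lambda>x v. f' x v + g' x v"])
      (auto intro!: has_derivative_add f' g' Suc.IH)
qed (auto intro: continuous_on_add)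

lemma Ck_on_sum:
  assumes "\<And>i. i \<in> I \<Longrightarrow> Ck_on k A (f i)"
  shows "Ck_on k A (\<lambda>x. \<Sum>i\<in>I. f i x)"
  using assms by (induction I rule: infinite_finite_induct) (auto intro: Ck_on_const Ck_on_add)

text \<open>The product rule leaves one undifferentiated factor in each term. Both factors are
  therefore first lowered from class k + 1 to class k by \<open>Ck_on_SucD\<close>, after which the
  induction hypothesis covers the two terms.\<close>

lemma (in bounded_bilinear) Ck_on:
  assumes "Ck_on k A f" "Ck_on k A g"
  shows "Ck_on k A (\<lambda>x. prod (f x) (g x))"
  using assms
proof (induction k arbitrary: f g)
  case (Suc k)
  obtain f' where f': "\<And>x. x \<in> A \<Longrightarrow> (f has_derivative f' x) (at x within A)"
    "\<And>v. Ck_on k A (\<lambda>x. f' x v)"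
    using Suc.prems(1) by (rule Ck_on_SucE) blast
  obtain g' where g': "\<And>x. x \<in> A \<Longrightarrow> (g has_derivative g' x) (at x within A)"
    "\<And>v. Ck_on k A (\<lambda>x. g' x v)"
    using Suc.prems(2) by (rule Ck_on_SucE) blast
  show ?case
    by (rule Ck_on_SucI[where f' = "\<lambda>x v. prod (f x) (g' x v) + prod (f' x v) (g x)"])
      (auto intro!: FDERIV f' g' Suc.IH Ck_on_add Ck_on_SucD[OF Suc.prems(1)] Ck_on_SucD[OF Suc.prems(2)])
qed (auto intro: continuous_on)

lemmas Ck_on_mult = bounded_bilinear.Ck_on[OF bounded_bilinear_mult]
lemmas Ck_on_inner = bounded_bilinear.Ck_on[OF bounded_bilinear_inner]

lemma Ck_on_prod:
  fixes f :: "'i \<Rightarrow> 'a::real_normed_vector \<Rightarrow> real"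
  assumes "\<And>i. i \<in> I \<Longrightarrow> Ck_on k A (f i)"
  shows "Ck_on k A (\<lambda>x. \<Prod>i\<in>I. f i x)"
  using assms by (induction I rule: infinite_finite_induct) (auto intro: Ck_on_const Ck_on_mult)

text \<open>The derivative of 1/f is built from 1/f itself and f'. The induction hypothesis makes
  1/f of class k, hence also its derivative.\<close>

lemma Ck_on_inverse:
  fixes f :: "'a::real_normed_vector \<Rightarrow> real"
  assumes "Ck_on k A f" "\<And>x. x \<in> A \<Longrightarrow> f x \<noteq> 0"
  shows "Ck_on k A (\<lambda>x. inverse (f x))"
  using assms
proof (induction k arbitrary: f)
  case (Suc k)
  obtain f' where f': "\<And>x. x \<in> A \<Longrightarrow> (f has_derivative f' x) (at x within A)"
    "\<And>v. Ck_on k A (\<lambda>x. f' x v)"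
    using Suc.prems(1) by (rule Ck_on_SucE) blast
  have inv: "Ck_on k A (\<lambda>x. inverse (f x))"
    using Suc by (auto dest: Ck_on_SucD)
  show ?case
  proof (rule Ck_on_SucI)
    \<comment> \<open>The sign is kept as a factor -1 so that the rules for products and constants
      suffice.\<close>
    show "((\<lambda>x. inverse (f x)) has_derivative (\<lambda>v. - 1 * (inverse (f x) * f' x v * inverse (f x))))
        (at x within A)" if "x \<in> A" for x
      using Deriv.has_derivative_inverse[OF Suc.prems(2)[OF that] f'(1)[OF that]] by simp
    show "Ck_on k A (\<lambda>x. - 1 * (inverse (f x) * f' x v * inverse (f x)))" for v
      by (intro Ck_on_mult Ck_on_const inv f')
  qed
qed (auto intro: continuous_on_inverse)

lemma Ck_on_sqrt:
  fixes f :: "'a::real_normed_vector \<Rightarrow> real"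
  assumes "Ck_on k A f" "\<And>x. x \<in> A \<Longrightarrow> f x > 0"
  shows "Ck_on k A (\<lambda>x. sqrt (f x))"
  using assms
proof (induction k arbitrary: f)
  case (Suc k)
  obtain f' where f': "\<And>x. x \<in> A \<Longrightarrow> (f has_derivative f' x) (at x within A)"
    "\<And>v. Ck_on k A (\<lambda>x. f' x v)"
    using Suc.prems(1) by (rule Ck_on_SucE) blast
  have sq: "Ck_on k A (\<lambda>x. sqrt (f x))"
    using Suc by (auto dest: Ck_on_SucD)
  show ?case
  proof (rule Ck_on_SucI)
    show "((\<lambda>x. sqrt (f x)) has_derivative (\<lambda>v. f' x v * inverse (2 * sqrt (f x))))
        (at x within A)" if "x \<in> A" for x
      using has_derivative_real_sqrt[OF Suc.prems(2)[OF that] f'(1)[OF that]]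
      by (simp add: field_simps)
    show "Ck_on k A (\<lambda>x. f' x v * inverse (2 * sqrt (f x)))" for v
      using Suc.prems(2)
      by (intro Ck_on_mult Ck_on_inverse Ck_on_const sq f') fastforce
  qed
qed (auto intro: continuous_on_real_sqrt)

text \<open>In direction v the composite has derivative f' at a + L x in the direction L v. Since L
  v does not depend on x, this is again a function of class k composed with the same affine map, and
  the induction closes without a general chain rule for \<open>Ck_on\<close>.\<close>

lemma Ck_on_compose_affine:
  assumes "Ck_on k A f" and L: "bounded_linear L" and maps: "\<And>x. x \<in> B \<Longrightarrow> a + L x \<in> A"
  shows "Ck_on k B (\<lambda>x. f (a + L x))"
  using assms(1)
proof (induction k arbitrary: f)
  case 0
  then show ?case
    using maps by (auto intro!: continuous_on_compose2[of A f B "\<lambda>x. a + L x"] continuous_intros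
        bounded_linear.continuous_on[OF L])
next
  case (Suc k)
  obtain f' where f': "\<And>x. x \<in> A \<Longrightarrow> (f has_derivative f' x) (at x within A)"
    "\<And>v. Ck_on k A (\<lambda>x. f' x v)"
    using Suc.prems(1) by (rule Ck_on_SucE) blast
  show ?case
  proof (rule Ck_on_SucI)
    show "((\<lambda>x. f (a + L x)) has_derivative (\<lambda>v. f' (a + L x) (L v))) (at x within B)"
      if "x \<in> B" for x
    proof (rule has_derivative_in_compose2[where g = f and t = A])
      show "((\<lambda>x. a + L x) has_derivative L) (at x within B)"
        using bounded_linear.has_derivative[OF L has_derivative_ident]
        by (auto intro!: derivative_eq_intros)
    qed (use f' maps that in auto)
    show "Ck_on k B (\<lambda>x. f' (a + L x) (L v))" for v
      by (rule Suc.IH) (rule f')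
  qed
qed

lemma Ck_on_det:
  fixes M :: "'a::real_normed_vector \<Rightarrow> real ^ 'n ^ 'n"
  assumes "\<And>i j. Ck_on k A (\<lambda>x. M x $ i $ j)"
  shows "Ck_on k A (\<lambda>x. det (M x))"
  unfolding det_def by (intro Ck_on_sum Ck_on_mult Ck_on_prod Ck_on_const assms)

lemma class_C_on_imp_Ck_on: "class_C_on r A f \<Longrightarrow> enat k \<le> r \<Longrightarrow> Ck_on k A f"
  by (simp add: class_C_on_def)

section \<open>Mixed partial derivatives and determinants\<close>

text \<open>Differentiate \<open>\<phi> s h = \<phi> a h + \<integral>\<^sub>a\<^sup>s P u h du\<close> in \<open>h\<close> under the integral sign; only
  \<open>s \<ge> a\<close> enters, so the boundary of the time interval is covered.\<close>

lemma mixed_partials_within: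
  fixes \<phi> P R :: "real \<Rightarrow> real \<Rightarrow> 'b::banach"
  assumes ab: "a < b" and d: "0 < d"
    and Fs: "\<And>s h. s \<in> {a..b} \<Longrightarrow> h \<in> {-d..d} \<Longrightarrow>
      ((\<lambda>s. \<phi> s h) has_vector_derivative P s h) (at s within {a..b})"
    and Fh: "\<And>s. s \<in> {a..b} \<Longrightarrow> (\<phi> s has_vector_derivative Q s) (at 0)"
    and Ph: "\<And>s h. s \<in> {a..b} \<Longrightarrow> h \<in> {-d..d} \<Longrightarrow>
      (P s has_vector_derivative R s h) (at h within {-d..d})"
    and R: "continuous_on ({-d..d} \<times> {a..b}) (\<lambda>(h, s). R s h)"
  shows "(Q has_vector_derivative R a 0) (at a within {a..b})"
proof -
  have FTC: "((\<lambda>u. P u h) has_integral (\<phi> s h - \<phi> a h)) {a..s}"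
    if "s \<in> {a..b}" "h \<in> {-d..d}" for s h
    using that by (intro fundamental_theorem_of_calculus has_vector_derivative_within_subset[OF Fs]) auto
  have Q: "Q s = Q a + integral {a..s} (\<lambda>u. R u 0)" if s: "s \<in> {a..b}" for s
  proof -
    have eq: "integral (cbox a s) (\<lambda>u. P u h) = \<phi> s h - \<phi> a h" if "h \<in> {-d..d}" for h
      using FTC[OF s that] by (auto simp: cbox_interval intro: integral_unique)
    have "((\<lambda>h. integral (cbox a s) (\<lambda>u. P u h)) has_vector_derivative
        integral (cbox a s) (\<lambda>u. R u 0)) (at 0 within {-d..d})"
    proof (rule leibniz_rule_vector_derivative[where fx = "\<lambda>h u. R u h"])
      show "continuous_on ({-d..d} \<times> cbox a s) (\<lambda>(h, u). R u h)"
        by (rule continuous_on_subset[OF R]) (use s in auto)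
      show "(\<lambda>u. P u h) integrable_on cbox a s" if "h \<in> {-d..d}" for h
        using FTC[OF s that] by (auto simp: cbox_interval intro: has_integral_integrable)
    qed (use s d Ph in \<open>auto simp: cbox_interval\<close>)
    then have Rd: "((\<lambda>h. \<phi> s h - \<phi> a h) has_vector_derivative
        integral (cbox a s) (\<lambda>u. R u 0)) (at 0 within {-d..d})"
      by (rule has_vector_derivative_transform[rotated 2]) (use d eq in auto)
    have Qd: "((\<lambda>h. \<phi> s h - \<phi> a h) has_vector_derivative (Q s - Q a)) (at 0 within {-d..d})"
      by (rule has_vector_derivative_at_within, rule has_vector_derivative_diff; rule Fh)
        (use s ab in auto)
    \<comment> \<open>\<open>Qd\<close> and \<open>Rd\<close> differentiate the same function of h
      at 0, so uniqueness of the derivative equates their values.\<close>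
    have "at 0 within {-d..d} \<noteq> bot"
      using d by (simp add: at_within_Icc_at)
    then have "Q s - Q a = integral (cbox a s) (\<lambda>u. R u 0)"
      using vector_derivative_within[OF _ Qd] vector_derivative_within[OF _ Rd] by simp
    then show ?thesis
      by (simp add: cbox_interval algebra_simps)
  qed
  have cont: "continuous_on {a..b} (\<lambda>u. R u 0)"
  proof -
    have "continuous_on {a..b} (\<lambda>u. (\<lambda>(h, s). R s h) (0, u))"
      by (rule continuous_on_compose2[OF R])
        (use d in \<open>auto intro!: continuous_on_Pair continuous_on_const continuous_on_id\<close>)
    then show ?thesis
      by simp
  qed
  have "((\<lambda>s. integral {a..s} (\<lambda>u. R u 0)) has_vector_derivative R a 0) (at a within {a..b})"
    by (rule integral_has_vector_derivative[OF cont]) (use ab in simp)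
  from has_vector_derivative_add[OF has_vector_derivative_const[of "Q a"] this]
  have "((\<lambda>s. Q a + integral {a..s} (\<lambda>u. R u 0)) has_vector_derivative R a 0) (at a within {a..b})"
    by simp
  then show ?thesis
    by (rule has_vector_derivative_transform[rotated 2, OF _ _ Q]) (use ab in auto)
qed

section \<open>Derivative and positivity of determinants\<close>

lemma DERIV_prod_within:
  fixes f :: "'i \<Rightarrow> real \<Rightarrow> real"
  assumes "\<And>i. i \<in> I \<Longrightarrow> (f i has_real_derivative f' i) (at t within A)"
  shows "((\<lambda>s. \<Prod>i\<in>I. f i s) has_real_derivative (\<Sum>i\<in>I. f' i * (\<Prod>k\<in>I - {i}. f k t)))
    (at t within A)"
  unfolding has_field_derivative_def
proof (rule has_derivative_eq_rhs)
  show "((\<lambda>s. \<Prod>i\<in>I. f i s) has_derivative (\<lambda>y. \<Sum>i\<in>I. f' i * y * (\<Prod>k\<in>I - {i}. f k t)))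
      (at t within A)"
    by (rule has_derivative_prod) (rule assms[unfolded has_field_derivative_def])
  show "(\<lambda>y. \<Sum>i\<in>I. f' i * y * (\<Prod>k\<in>I - {i}. f k t)) =
      (*) (\<Sum>i\<in>I. f' i * (\<Prod>k\<in>I - {i}. f k t))"
    unfolding fun_eq_iff sum_distrib_right by (simp only: mult_ac simp_thms)
qed

text \<open>Differentiating the Leibniz formula gives a sum of determinants in which one row of M is
  replaced by the same row of M'. Because M' = (M' N) M, the new row is a combination of the rows of
  M, and Cramer's rule leaves only the diagonal entry of M' N times det M.\<close>

lemma det_has_derivative_Jacobi:
  fixes M :: "real \<Rightarrow> real ^ 'n ^ 'n"
  assumes M: "\<And>i j. ((\<lambda>s. M s $ i $ j) has_real_derivative M' $ i $ j) (at t within A)"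
    and N: "N ** M t = mat 1"
  shows "((\<lambda>s. det (M s)) has_real_derivative
    det (M t) * (\<Sum>i\<in>UNIV. \<Sum>j\<in>UNIV. M' $ i $ j * N $ j $ i)) (at t within A)"
proof -
  let ?P = "{p. p permutes (UNIV :: 'n set)}"
  let ?C = "M' ** N"
  have row: "(\<Sum>k\<in>UNIV. ?C $ i $ k *s row k (M t)) = row i M'" for i
  proof -
    have "?C ** M t = M'"
      by (simp add: matrix_mul_assoc[symmetric] N)
    then have "row i (?C ** M t) = row i M'"
      by simp
    then show ?thesis
      by (simp add: vec_eq_iff row_def matrix_matrix_mult_def sum_component)
  qed
  have "((\<lambda>s. det (M s)) has_real_derivative
      (\<Sum>p\<in>?P. of_int (sign p) * (\<Sum>i\<in>UNIV. M' $ i $ p i * (\<Prod>k\<in>UNIV - {i}. M t $ k $ p k))))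
      (at t within A)"
    unfolding det_def
    by (rule DERIV_sum, rule DERIV_cmult, rule DERIV_prod_within, rule M)
  also have "(\<Sum>p\<in>?P. of_int (sign p) * (\<Sum>i\<in>UNIV. M' $ i $ p i * (\<Prod>k\<in>UNIV - {i}. M t $ k $ p k))) =
      (\<Sum>i\<in>UNIV. \<Sum>p\<in>?P. of_int (sign p) * (M' $ i $ p i * (\<Prod>k\<in>UNIV - {i}. M t $ k $ p k)))"
    unfolding sum_distrib_left by (rule sum.swap)
  \<comment> \<open>Grouped by the differentiated row i, the inner sum over permutations is the
    Leibniz formula of M with row i exchanged.\<close>
  also have "\<dots> = (\<Sum>i\<in>UNIV. det (\<chi> k. if k = i then row i M' else row k (M t)))"
  proof (intro sum.cong refl)
    fix i
    have "(\<Prod>k\<in>UNIV. (if k = i then row i M' else row k (M t)) $ p k) =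
        M' $ i $ p i * (\<Prod>k\<in>UNIV - {i}. M t $ k $ p k)" for p
      by (subst prod.remove[of UNIV i]) (auto simp: row_def)
    then show "(\<Sum>p\<in>?P. of_int (sign p) * (M' $ i $ p i * (\<Prod>k\<in>UNIV - {i}. M t $ k $ p k))) =
        det (\<chi> k. if k = i then row i M' else row k (M t))"
      by (simp add: det_def)
  qed
  also have "\<dots> = (\<Sum>i\<in>UNIV. ?C $ i $ i * det (M t))"
    unfolding row[symmetric] cramer_lemma_transpose ..
  also have "\<dots> = det (M t) * (\<Sum>i\<in>UNIV. \<Sum>j\<in>UNIV. M' $ i $ j * N $ j $ i)"
    by (simp add: matrix_matrix_mult_def sum_distrib_right sum_distrib_left mult.commute)
  finally show ?thesis .
qed

text \<open>Along the segment from the identity to G all matrices stay positive definite, hence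
  invertible. The determinant starts at 1 and, by the intermediate value theorem, cannot become
  nonpositive without vanishing on the way.\<close>

lemma det_pos_if_positive_definite:
  fixes G :: "real ^ 'n ^ 'n"
  assumes pos: "\<And>w. w \<noteq> 0 \<Longrightarrow> 0 < w \<bullet> (G *v w)"
  shows "0 < det G"
proof (rule ccontr)
  assume "\<not> 0 < det G"
  define K where "K s = (1 - s) *\<^sub>R mat 1 + s *\<^sub>R G" for s :: real
  have K0: "K 0 = mat 1" and K1: "K 1 = G"
    by (simp_all add: K_def)
  have "continuous_on {0..1} (\<lambda>s. det (K s))"
    unfolding det_def K_def by (auto intro!: continuous_intros)
  then obtain s where s: "0 \<le> s" "s \<le> 1" "det (K s) = 0"
    using IVT2'[of "\<lambda>s. det (K s)" 1 0 0] \<open>\<not> 0 < det G\<close> by (auto simp: K0 K1)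
  then obtain w where w: "w \<noteq> 0" "K s *v w = 0"
    by (metis invertible_det_nz matrix_left_invertible_ker invertible_left_inverse)
  then have "0 = w \<bullet> (K s *v w)"
    by simp
  also have "\<dots> = (1 - s) * (w \<bullet> w) + s * (w \<bullet> (G *v w))"
    by (simp add: K_def matrix_vector_mult_add_rdistrib scaleR_matrix_vector_assoc[symmetric]
        inner_add_right)
  also have "\<dots> > 0"
  proof (cases "s = 0")
    case False
    with s pos[OF w(1)] show ?thesis
      by (intro add_nonneg_pos) auto
  qed (use w in simp)
  finally show False
    by simp
qed

section \<open>Time-dependent functions in a chart\<close>

text \<open>Room to the right of t is all that is used, so t = 0 is included. The first fact makes
  derivatives within the interval unique; the second supplies the compact interval for
  \<open>mixed_partials_within\<close>.\<close>

lemma time_interval_trivial_limit: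
  assumes "t \<in> time_interval T"
  shows "at t within time_interval T \<noteq> bot"
    and "\<exists>b>t. {t..b} \<subseteq> time_interval T"
proof -
  from assms have t: "0 \<le> t" "ereal t < T"
    by (auto simp: time_interval_def)
  obtain b where b: "ereal t < ereal b" "ereal b < T"
    using ereal_dense2[OF t(2)] by auto
  have sub: "{t..b} \<subseteq> time_interval T"
  proof
    fix s assume "s \<in> {t..b}"
    then show "s \<in> time_interval T"
      using t le_less_trans[of "ereal s" "ereal b" T] b by (simp add: time_interval_def)
  qed
  then show "\<exists>b>t. {t..b} \<subseteq> time_interval T"
    using b by auto
  have "at t within {t..b} \<noteq> bot"
    using b by (simp add: at_within_Icc_at_right trivial_limit_at_right_real)
  then show "at t within time_interval T \<noteq> bot"
    using at_le[OF sub, of t] by (auto simp: le_bot)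
qed

lemma time_interval_convex: "convex (time_interval T)"
proof -
  have "x \<in> time_interval T" if "a \<in> time_interval T" "b \<in> time_interval T" "a \<le> x" "x \<le> b" for a b x
    using that le_less_trans[of "ereal x" "ereal b" T] by (simp add: time_interval_def)
  then have "is_interval (time_interval T)"
    unfolding is_interval_1 by blast
  then show ?thesis
    by (simp add: is_interval_convex_1)
qed

lemma zero_in_time_interval: "0 < T \<Longrightarrow> 0 \<in> time_interval T"
  by (simp add: time_interval_def zero_ereal_def[symmetric])

text \<open>One chart and one finite order of \<open>class_C_family\<close>, with the pair (t, x)
  accessed by projections so that it fits the \<open>Ck_on\<close> rules directly.\<close>

definition chart_Ck :: "nat \<Rightarrow> ereal \<Rightarrow> ('m, 'n::finite) chart
    \<Rightarrow> (real \<Rightarrow> 'm \<Rightarrow> 'b::real_normed_vector) \<Rightarrow> bool" where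
  "chart_Ck k T c f \<longleftrightarrow>
    Ck_on k (time_interval T \<times> coord c ` cdom c) (\<lambda>z. f (fst z) (param c (snd z)))"

text \<open>The value of \<open>partial\<close> is arbitrary where the derivative does not exist; this relation also asserts
  existence.\<close>

definition has_partial ::
    "('m, 'n::finite) chart \<Rightarrow> 'n \<Rightarrow> ('m \<Rightarrow> 'b::real_normed_vector) \<Rightarrow> 'm \<Rightarrow> 'b \<Rightarrow> bool" where
  "has_partial c i f p D \<longleftrightarrow>
    ((\<lambda>s. f (param c (coord c p + s *\<^sub>R axis i 1))) has_vector_derivative D) (at 0)"

lemma partial_eqI: "has_partial c i f p D \<Longrightarrow> partial c i f p = D"
  by (simp add: has_partial_def partial_def vector_derivative_at)

lemma class_C_family_imp_chart_Ck:
  "class_C_family r T \<A> f \<Longrightarrow> c \<in> \<A> \<Longrightarrow> enat k \<le> r \<Longrightarrow> chart_Ck k T c f"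
  by (auto simp: class_C_family_def chart_Ck_def class_C_on_def split_beta')

lemma chart_Ck_inner:
  fixes f g :: "real \<Rightarrow> 'm \<Rightarrow> 'b::real_inner"
  shows "chart_Ck k T c f \<Longrightarrow> chart_Ck k T c g \<Longrightarrow> chart_Ck k T c (\<lambda>t p. f t p \<bullet> g t p)"
  unfolding chart_Ck_def by (rule Ck_on_inner)

section \<open>Calculus in a single chart\<close>

locale manifold_chart =
  fixes c :: "('m::topological_space, 'n::finite) chart"
  assumes is_chart: "is_chart c"
begin

abbreviation U :: "(real ^ 'n) set" where
  "U \<equiv> coord c ` cdom c"

lemma open_U: "open U"
  using is_chart by (simp add: is_chart_def)

lemma param_coord: "p \<in> cdom c \<Longrightarrow> param c (coord c p) = p"
  using is_chart by (auto simp: is_chart_def homeomorphism_def)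

lemma coord_param: "x \<in> U \<Longrightarrow> coord c (param c x) = x"
  using param_coord by fastforce

lemma param_in_cdom: "x \<in> U \<Longrightarrow> param c x \<in> cdom c"
  using param_coord by fastforce

lemma coordinate_line:
  assumes "p \<in> cdom c"
  obtains d where "0 < d" "\<And>s. \<bar>s\<bar> < d \<Longrightarrow> coord c p + s *\<^sub>R axis i 1 \<in> U"
proof -
  obtain d where "0 < d" "ball (coord c p) d \<subseteq> U"
    using open_U assms by (meson imageI open_contains_ball)
  then show ?thesis
    by (intro that[of d]) (auto simp: dist_norm norm_axis_1 subset_iff)
qed

text \<open>Only a short piece of the coordinate line through p enters the derivative, and it stays
  in the chart domain because the coordinate image is open.\<close>

lemma has_partial_cong:
  assumes "p \<in> cdom c" "has_partial c i f p D" "\<And>q. q \<in> cdom c \<Longrightarrow> f q = g q"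
  shows "has_partial c i g p D"
proof -
  obtain d where d: "0 < d" "\<And>s. \<bar>s\<bar> < d \<Longrightarrow> coord c p + s *\<^sub>R axis i 1 \<in> U"
    using coordinate_line[OF assms(1)] by blast
  then have "f (param c (coord c p + s *\<^sub>R axis i 1)) = g (param c (coord c p + s *\<^sub>R axis i 1))"
    if "\<bar>s\<bar> < d" for s
    using that by (intro assms(3) param_in_cdom) auto
  then show ?thesis
    using assms(2) d(1) unfolding has_partial_def
    by (auto elim!: has_vector_derivative_transform_within[where d = d] simp: dist_norm)
qed

lemma partial_const: "p \<in> cdom c \<Longrightarrow> (\<And>q. q \<in> cdom c \<Longrightarrow> f q = a) \<Longrightarrow> partial c i f p = 0"
  by (rule partial_eqI[OF has_partial_cong[where f = "\<lambda>_. a"]]) (auto simp: has_partial_def)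

text \<open>\<open>has_partial\<close> differentiates at parameter 0 on a line based at the point
  itself. Rebasing the line at x gives the derivative at any parameter h, as required along the
  edges in \<open>mixed_partials_within\<close>.\<close>

lemma has_partial_at_shift:
  assumes "x + h *\<^sub>R axis i 1 \<in> U" "has_partial c i f (param c (x + h *\<^sub>R axis i 1)) D"
  shows "((\<lambda>h. f (param c (x + h *\<^sub>R axis i 1))) has_vector_derivative D) (at h)"
proof -
  have "((\<lambda>s. f (param c (x + (h + s) *\<^sub>R axis i 1))) has_vector_derivative D) (at 0)"
    using assms by (simp add: has_partial_def coord_param scaleR_add_left add.assoc)
  then have "(((\<lambda>s. f (param c (x + (h + s) *\<^sub>R axis i 1))) \<circ> (\<lambda>u. u - h))
      has_vector_derivative 1 *\<^sub>R D) (at h)"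
    by (intro vector_diff_chain_at) (auto intro!: derivative_eq_intros)
  then show ?thesis
    by (simp add: o_def)
qed

lemma has_partial_bilinear:
  assumes "bounded_bilinear pr" "p \<in> cdom c" "has_partial c i f p D" "has_partial c i g p E"
  shows "has_partial c i (\<lambda>q. pr (f q) (g q)) p (pr (f p) E + pr D (g p))"
  using bounded_bilinear.has_vector_derivative[OF assms(1) assms(3,4)[unfolded has_partial_def]]
  by (simp add: has_partial_def param_coord assms(2))

lemmas has_partial_inner = has_partial_bilinear[OF bounded_bilinear_inner]
lemmas has_partial_mult = has_partial_bilinear[OF bounded_bilinear_mult]

lemma chart_Ck_continuous:
  assumes "chart_Ck k T c f"
  shows "continuous_on (time_interval T \<times> U) (\<lambda>z. f (fst z) (param c (snd z)))"
  using assms unfolding chart_Ck_def by (rule Ck_on_imp_continuous_on)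

text \<open>The total derivative on [0,T) x U, evaluated in the constant directions (1, 0) and (0,
  axis i 1), yields the time and coordinate derivatives. \<open>Ck_on\<close> asserts class k for
  precisely such directional derivatives.\<close>

lemma chart_Ck_Suc_derivatives:
  assumes f: "chart_Ck (Suc k) T c f"
  shows time_deriv_has_derivative: "\<And>t p. t \<in> time_interval T \<Longrightarrow> p \<in> cdom c \<Longrightarrow>
      ((\<lambda>s. f s p) has_vector_derivative time_deriv T f t p) (at t within time_interval T)"
    and has_partial_partial: "\<And>t p i. t \<in> time_interval T \<Longrightarrow> p \<in> cdom c \<Longrightarrow>
      has_partial c i (f t) p (partial c i (f t) p)"
    and chart_Ck_time_deriv: "chart_Ck k T c (time_deriv T f)"
    and chart_Ck_partial: "\<And>i. chart_Ck k T c (\<lambda>t. partial c i (f t))"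
proof -
  let ?A = "time_interval T \<times> U"
  let ?f = "\<lambda>z. f (fst z) (param c (snd z))"
  obtain f' where f': "\<And>z. z \<in> ?A \<Longrightarrow> (?f has_derivative f' z) (at z within ?A)"
    and Ck: "\<And>v. Ck_on k ?A (\<lambda>z. f' z v)"
    using f unfolding chart_Ck_def by (rule Ck_on_SucE) blast
  have time: "((\<lambda>s. f s p) has_vector_derivative f' (t, coord c p) (1, 0)) (at t within time_interval T)"
    if tp: "t \<in> time_interval T" "p \<in> cdom c" for t p
  proof -
    have "((\<lambda>s. ?f (s, coord c p)) has_derivative (\<lambda>s. f' (t, coord c p) (s, 0)))
        (at t within time_interval T)"
      by (rule has_derivative_in_compose2[where g = ?f and t = ?A, OF f' _ tp(1)
            has_derivative_Pair[OF has_derivative_ident has_derivative_const]]) (use tp in auto)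
    moreover have eq: "f' (t, coord c p) (s, 0) = s *\<^sub>R f' (t, coord c p) (1, 0)" for s
      using linear_cmul[OF has_derivative_linear[OF f'[of "(t, coord c p)"]], of s "(1, 0)"] tp
      by auto
    ultimately have "((\<lambda>s. ?f (s, coord c p)) has_derivative (\<lambda>s. s *\<^sub>R f' (t, coord c p) (1, 0)))
        (at t within time_interval T)"
      by (subst (asm) eq)
    then show ?thesis
      using tp by (simp add: has_vector_derivative_def param_coord)
  qed
  have pd: "has_partial c i (f t) p (f' (t, coord c p) (0, axis i 1))"
    if tp: "t \<in> time_interval T" "p \<in> cdom c" for t p i
  proof -
    \<comment> \<open>The parameters whose line point lies in U form an open set, so the derivative
      within it is a two-sided derivative at 0.\<close>
    let ?B = "(\<lambda>s. coord c p + s *\<^sub>R axis i 1) -` U"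
    have B: "open ?B" "0 \<in> ?B"
      using tp(2) by (auto intro!: open_vimage open_U continuous_intros)
    have line: "((\<lambda>s. coord c p + s *\<^sub>R axis i 1) has_derivative (\<lambda>s. s *\<^sub>R axis i 1)) (at 0 within ?B)"
      by (rule has_derivative_eq_rhs, rule has_derivative_add[OF has_derivative_const
            has_derivative_scaleR_left[OF has_derivative_ident]]) simp
    have "((\<lambda>s. ?f (t, coord c p + s *\<^sub>R axis i 1)) has_derivative
        (\<lambda>s. f' (t, coord c p + 0 *\<^sub>R axis i 1) (0, s *\<^sub>R axis i 1))) (at 0 within ?B)"
      by (rule has_derivative_in_compose2[where g = ?f and t = ?A, OF f' _ B(2)
            has_derivative_Pair[OF has_derivative_const line]]) (use tp in auto)
    moreover have "f' (t, coord c p) (0, s *\<^sub>R axis i 1) = s *\<^sub>R f' (t, coord c p) (0, axis i 1)" for s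
      using linear_cmul[OF has_derivative_linear[OF f'[of "(t, coord c p)"]], of s "(0, axis i 1)"] tp
      by simp
    ultimately have "((\<lambda>s. ?f (t, coord c p + s *\<^sub>R axis i 1)) has_vector_derivative
        f' (t, coord c p) (0, axis i 1)) (at 0 within ?B)"
      by (simp add: has_vector_derivative_def)
    then show ?thesis
      using at_within_open[OF B(2,1)] by (simp add: has_partial_def)
  qed
  have time_eq: "time_deriv T f t p = f' (t, coord c p) (1, 0)"
    if tp: "t \<in> time_interval T" "p \<in> cdom c" for t p
    unfolding time_deriv_def
    by (intro vector_derivative_within time time_interval_trivial_limit tp)
  note pd_eq = partial_eqI[OF pd]
  show "((\<lambda>s. f s p) has_vector_derivative time_deriv T f t p) (at t within time_interval T)"
    if "t \<in> time_interval T" "p \<in> cdom c" for t p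
    using time[OF that] time_eq[OF that] by simp
  show "has_partial c i (f t) p (partial c i (f t) p)"
    if "t \<in> time_interval T" "p \<in> cdom c" for t p i
    using pd[OF that] pd_eq[OF that] by simp
  show "chart_Ck k T c (time_deriv T f)"
    unfolding chart_Ck_def
    by (rule Ck_on_cong[OF Ck[of "(1, 0)"]]) (auto simp: time_eq param_coord)
  show "chart_Ck k T c (\<lambda>t. partial c i (f t))" for i
    unfolding chart_Ck_def
    by (rule Ck_on_cong[OF Ck[of "(0, axis i 1)"]]) (auto simp: pd_eq param_coord)
qed

text \<open>Regularity of the family already gives the time derivative of the partial on the whole
  interval. \<open>mixed_partials_within\<close> on [t, b] serves only to identify its value, by
  uniqueness.\<close>

lemma partial_has_time_derivative:
  fixes f :: "real \<Rightarrow> 'm \<Rightarrow> 'b::banach"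
  assumes f: "chart_Ck (Suc (Suc k)) T c f" and t: "t \<in> time_interval T" and p: "p \<in> cdom c"
  shows "((\<lambda>s. partial c i (f s) p) has_vector_derivative partial c i (time_deriv T f t) p)
    (at t within time_interval T)"
proof -
  let ?D = "time_deriv T (\<lambda>s. partial c i (f s)) t p"
  have D: "((\<lambda>s. partial c i (f s) p) has_vector_derivative ?D) (at t within time_interval T)"
    by (rule time_deriv_has_derivative[OF chart_Ck_partial[OF f] t p])
  obtain b where b: "t < b" and sub: "{t..b} \<subseteq> time_interval T"
    using time_interval_trivial_limit(2)[OF t] by blast
  obtain d' where d': "0 < d'" "\<And>s. \<bar>s\<bar> < d' \<Longrightarrow> coord c p + s *\<^sub>R axis i 1 \<in> U"
    using coordinate_line[OF p] by blast
  \<comment> \<open>Halving turns the open parameter range into a closed interval on which the line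
    still lies in U.\<close>
  define d where "d = d' / 2"
  let ?q = "\<lambda>h. param c (coord c p + h *\<^sub>R axis i 1)"
  have d: "0 < d" "\<And>s. s \<in> {-d..d} \<Longrightarrow> coord c p + s *\<^sub>R axis i 1 \<in> U"
    using d' by (auto simp: d_def)
  have dp: "?q h \<in> cdom c" if "h \<in> {-d..d}" for h
    using d(2)[OF that] by (rule param_in_cdom)
  have "((\<lambda>s. partial c i (f s) p) has_vector_derivative partial c i (time_deriv T f t) (?q 0))
      (at t within {t..b})"
  proof (rule mixed_partials_within[where \<phi> = "\<lambda>s h. f s (?q h)"
        and P = "\<lambda>s h. time_deriv T f s (?q h)"
        and R = "\<lambda>s h. partial c i (time_deriv T f s) (?q h)", OF b d(1)])
    show "((\<lambda>s. f s (?q h)) has_vector_derivative time_deriv T f s (?q h)) (at s within {t..b})"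
      if "s \<in> {t..b}" "h \<in> {-d..d}" for s h
      by (rule has_vector_derivative_within_subset[OF _ sub],
          rule time_deriv_has_derivative[OF f _ dp[OF that(2)]])
        (use that(1) sub in blast)
    show "((\<lambda>h. f s (?q h)) has_vector_derivative partial c i (f s) p) (at 0)"
      if "s \<in> {t..b}" for s
      using has_partial_partial[OF f _ p, of s i] that sub by (auto simp: has_partial_def)
    show "((\<lambda>h. time_deriv T f s (?q h)) has_vector_derivative
        partial c i (time_deriv T f s) (?q h)) (at h within {-d..d})"
      if "s \<in> {t..b}" "h \<in> {-d..d}" for s h
      by (rule has_vector_derivative_at_within, rule has_partial_at_shift[OF d(2)[OF that(2)]],
          rule has_partial_partial[OF chart_Ck_time_deriv[OF f] _ dp[OF that(2)]])
        (use that(1) sub in blast)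
    have "continuous_on ({-d..d} \<times> {t..b}) (\<lambda>z. (\<lambda>z. partial c i (time_deriv T f (fst z)) (param c (snd z)))
        (snd z, coord c p + fst z *\<^sub>R axis i 1))"
      by (rule continuous_on_compose2[OF chart_Ck_continuous[OF chart_Ck_partial[OF chart_Ck_time_deriv[OF f]]]])
        (use d(2) sub in \<open>auto intro!: continuous_intros\<close>)
    then show "continuous_on ({-d..d} \<times> {t..b}) (\<lambda>(h, s). partial c i (time_deriv T f s) (?q h))"
      by (simp add: split_beta')
  qed
  moreover have "((\<lambda>s. partial c i (f s) p) has_vector_derivative ?D) (at t within {t..b})"
    using D sub by (rule has_vector_derivative_within_subset)
  moreover have "at t within {t..b} \<noteq> bot"
    using b by (simp add: at_within_Icc_at_right trivial_limit_at_right_real)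
  ultimately have "?D = partial c i (time_deriv T f t) p"
    using p by (metis vector_derivative_within param_coord scaleR_zero_left add.right_neutral)
  with D show ?thesis
    by simp
qed

text \<open>\<open>mixed_partials_within\<close> at fixed t, with the parameter along the j-th
  coordinate in the role of time.\<close>

lemma partial_commute:
  fixes f :: "real \<Rightarrow> 'm \<Rightarrow> 'b::banach"
  assumes f: "chart_Ck (Suc (Suc k)) T c f" and t: "t \<in> time_interval T" and p: "p \<in> cdom c"
  shows "partial c j (partial c i (f t)) p = partial c i (partial c j (f t)) p"
proof -
  obtain d' where d': "0 < d'" "ball (coord c p) d' \<subseteq> U"
    using open_U p by (meson imageI open_contains_ball)
  \<comment> \<open>Points of the parameter rectangle move by at most |s| + |h| \<le> 2d, which is
    less than d'.\<close>
  define d where "d = d' / 3"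
  have d: "0 < d"
    using d' by (simp add: d_def)
  let ?x = "\<lambda>s h. coord c p + s *\<^sub>R axis j 1 + h *\<^sub>R axis i 1"
  let ?q = "\<lambda>s h. param c (?x s h)"
  have U: "?x s h \<in> U" if "s \<in> {0..d}" "h \<in> {-d..d}" for s h
  proof -
    have "norm (s *\<^sub>R axis j (1::real) + h *\<^sub>R axis i 1) \<le> \<bar>s\<bar> + \<bar>h\<bar>"
      by (rule order_trans[OF norm_triangle_ineq]) (simp add: norm_axis_1)
    also have "\<dots> < d'"
      using that d'(1) by (auto simp: d_def)
    finally have "?x s h \<in> ball (coord c p) d'"
      by (simp add: dist_norm norm_minus_commute algebra_simps)
    then show ?thesis
      using d'(2) by blast
  qed
  have U': "coord c p + h *\<^sub>R axis i 1 + s *\<^sub>R axis j 1 \<in> U" if "s \<in> {0..d}" "h \<in> {-d..d}" for s h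
    using U[OF that] by (simp add: algebra_simps)
  have q: "?q s h \<in> cdom c" if "s \<in> {0..d}" "h \<in> {-d..d}" for s h
    using U[OF that] by (rule param_in_cdom)
  have line: "?q s 0 = param c (coord c p + s *\<^sub>R axis j 1)" for s
    by simp
  have "((\<lambda>s. partial c i (f t) (?q s 0)) has_vector_derivative
      partial c i (partial c j (f t)) (?q 0 0)) (at 0 within {0..d})"
  proof (rule mixed_partials_within[where \<phi> = "\<lambda>s h. f t (?q s h)"
        and P = "\<lambda>s h. partial c j (f t) (?q s h)"
        and R = "\<lambda>s h. partial c i (partial c j (f t)) (?q s h)", OF d d])
    show "((\<lambda>s. f t (?q s h)) has_vector_derivative partial c j (f t) (?q s h)) (at s within {0..d})"
      if "s \<in> {0..d}" "h \<in> {-d..d}" for s h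
    proof -
      have "((\<lambda>s. f t (param c ((coord c p + h *\<^sub>R axis i 1) + s *\<^sub>R axis j 1)))
          has_vector_derivative partial c j (f t) (?q s h)) (at s)"
        using has_partial_at_shift[OF U'[OF that]] has_partial_partial[OF f t q[OF that], of j]
        by (simp add: algebra_simps)
      then show ?thesis
        by (simp add: algebra_simps has_vector_derivative_at_within)
    qed
    show "((\<lambda>h. f t (?q s h)) has_vector_derivative partial c i (f t) (?q s 0)) (at 0)"
      if "s \<in> {0..d}" for s
      by (rule has_partial_at_shift[OF U has_partial_partial[OF f t q]]) (use that d in auto)
    show "((\<lambda>h. partial c j (f t) (?q s h)) has_vector_derivative
        partial c i (partial c j (f t)) (?q s h)) (at h within {-d..d})"
      if "s \<in> {0..d}" "h \<in> {-d..d}" for s h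
      using has_partial_at_shift[OF U[OF that] has_partial_partial[OF chart_Ck_partial[OF f] t q[OF that]]]
      by (rule has_vector_derivative_at_within)
    have "continuous_on ({-d..d} \<times> {0..d})
        (\<lambda>z. (\<lambda>z. partial c i (partial c j (f (fst z))) (param c (snd z))) (t, ?x (snd z) (fst z)))"
      by (rule continuous_on_compose2[OF chart_Ck_continuous[OF chart_Ck_partial[OF chart_Ck_partial[OF f]]]])
        (use U t in \<open>auto intro!: continuous_intros\<close>)
    then show "continuous_on ({-d..d} \<times> {0..d}) (\<lambda>(h, s). partial c i (partial c j (f t)) (?q s h))"
      by (simp add: split_beta')
  qed
  then have "((\<lambda>s. partial c i (f t) (param c (coord c p + s *\<^sub>R axis j 1))) has_vector_derivative
      partial c i (partial c j (f t)) p) (at 0 within {0..d})"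
    by (simp add: param_coord p)
  moreover have "((\<lambda>s. partial c i (f t) (param c (coord c p + s *\<^sub>R axis j 1))) has_vector_derivative
      partial c j (partial c i (f t)) p) (at 0 within {0..d})"
    using has_partial_partial[OF chart_Ck_partial[OF f] t p] unfolding has_partial_def
    by (rule has_vector_derivative_at_within)
  moreover have "at 0 within {0..d} \<noteq> bot"
    using d by (simp add: at_within_Icc_at_right trivial_limit_at_right_real)
  ultimately show ?thesis
    using vector_derivative_within by (metis (no_types))
qed

end

section \<open>Geometry of the evolving hypersurface\<close>

lemma matrix_inv:
  fixes A :: "real ^ 'n ^ 'n"
  assumes "invertible A"
  shows "A ** matrix_inv A = mat 1" "matrix_inv A ** A = mat 1"
  using someI_ex[OF assms[unfolded invertible_def]] by (simp_all add: matrix_inv_def)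

lemma inv_symmetric_matrix:
  fixes G :: "real ^ 'n ^ 'n"
  assumes "invertible G" "transpose G = G"
  shows "transpose (matrix_inv G) = matrix_inv G"
proof -
  have "transpose (matrix_inv G) ** G = mat 1"
    using arg_cong[OF matrix_inv(1)[OF assms(1)], of transpose] assms(2)
    by (simp add: matrix_transpose_mul)
  then have "transpose (matrix_inv G) ** (G ** matrix_inv G) = matrix_inv G"
    by (simp add: matrix_mul_assoc)
  then show ?thesis
    using matrix_inv(1)[OF assms(1)] by simp
qed

text \<open>The quadratic form of the Gram matrix at w is the squared norm of the combination of the
  E i with coefficients w.\<close>

lemma gram_positive_definite:
  fixes E :: "'n::finite \<Rightarrow> real ^ 'd::finite"
  assumes "\<And>w. (\<Sum>i\<in>UNIV. w $ i *\<^sub>R E i) = 0 \<Longrightarrow> w = 0" and "w \<noteq> 0"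
  shows "0 < w \<bullet> ((\<chi> i j. E i \<bullet> E j) *v w)"
proof -
  have "w \<bullet> ((\<chi> i j. E i \<bullet> E j) *v w) = (\<Sum>i\<in>UNIV. w $ i * (\<Sum>j\<in>UNIV. (E i \<bullet> E j) * w $ j))"
    by (simp add: inner_vec_def[of w] matrix_vector_mult_def)
  also have "\<dots> = (\<Sum>i\<in>UNIV. w $ i *\<^sub>R E i) \<bullet> (\<Sum>j\<in>UNIV. w $ j *\<^sub>R E j)"
    by (subst inner_sum_left) (simp add: inner_sum_right sum_distrib_left mult_ac)
  finally have "w \<bullet> ((\<chi> i j. E i \<bullet> E j) *v w) = (\<Sum>i\<in>UNIV. w $ i *\<^sub>R E i) \<bullet> (\<Sum>i\<in>UNIV. w $ i *\<^sub>R E i)" .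
  then show ?thesis
    using assms by auto
qed

text \<open>By a dimension count \<nu> and the E i span the whole space. The difference of the two
  sides is orthogonal to all of them, hence to itself.\<close>

lemma hypersurface_frame_decomposition:
  fixes E :: "'n::finite \<Rightarrow> real ^ 'd::finite" and \<nu> v :: "real ^ 'd"
  assumes dim: "CARD('d) = CARD('n) + 1"
    and inj: "\<And>w. (\<Sum>i\<in>UNIV. w $ i *\<^sub>R E i) = 0 \<Longrightarrow> w = 0"
    and \<nu>: "norm \<nu> = 1" "\<And>i. \<nu> \<bullet> E i = 0"
    and N: "(\<chi> i j. E i \<bullet> E j) ** N = mat 1"
  shows "v = (v \<bullet> \<nu>) *\<^sub>R \<nu> + (\<Sum>k\<in>UNIV. (N *v (\<chi> i. v \<bullet> E i)) $ k *\<^sub>R E k)"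
proof -
  define L where "L w = (\<Sum>i\<in>UNIV. w $ i *\<^sub>R E i)" for w :: "real ^ 'n"
  have L: "linear L"
    by (rule linearI) (simp_all add: L_def scaleR_add_left sum.distrib scaleR_sum_right)
  have "inj L"
    using inj by (simp add: linear_injective_0[OF L] L_def)
  then have dimL: "dim (range L) = CARD('n)"
    using dim_image_eq[OF L, of UNIV] by simp
  have perp: "\<nu> \<bullet> L w = 0" for w
    by (simp add: L_def inner_sum_right \<nu>)
  have sp: "span (range L) = range L"
    using subspace_UNIV L by (simp add: span_eq_iff linear_subspace_image)
  have "\<nu> \<notin> span (range L)"
    unfolding sp using perp \<nu>(1) by (metis imageE inner_eq_zero_iff norm_zero zero_neq_one)
  then have "dim (insert \<nu> (range L)) = DIM(real ^ 'd)"
    using dim dimL by (simp add: dim_insert)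
  then have span: "span (insert \<nu> (range L)) = UNIV"
    by (rule dim_eq_full[THEN iffD1])
  define S where "S = N *v (\<chi> i. v \<bullet> E i)"
  define w where "w = v - ((v \<bullet> \<nu>) *\<^sub>R \<nu> + L S)"
  \<comment> \<open>Since N inverts the Gram matrix, the tangential part has the same inner products
    with the E j as v.\<close>
  have "w \<bullet> E j = 0" for j
  proof -
    have "v \<bullet> E j = ((\<chi> i j. E i \<bullet> E j) *v S) $ j"
      using N by (simp add: S_def matrix_vector_mul_assoc)
    also have "\<dots> = (\<Sum>i\<in>UNIV. (E j \<bullet> E i) * S $ i)"
      by (simp add: matrix_vector_mult_def)
    also have "\<dots> = L S \<bullet> E j"
      by (simp add: L_def inner_sum_left inner_commute[of "E j"] mult.commute)
    finally show ?thesis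
      by (simp add: w_def inner_diff_left inner_add_left \<nu>)
  qed
  then have "w \<bullet> L u = 0" for u
    by (simp add: L_def inner_sum_right)
  moreover have "w \<bullet> \<nu> = 0"
    using \<nu>(1) perp[of S]
    by (simp add: w_def inner_commute[of _ \<nu>] inner_diff_right inner_add_right dot_square_norm)
  ultimately have "\<And>x. x \<in> insert \<nu> (range L) \<Longrightarrow> orthogonal w x"
    by (auto simp: orthogonal_def)
  then have "orthogonal w w"
    using orthogonal_to_span[of w "insert \<nu> (range L)" w] by (simp add: span)
  then have "w = 0"
    by (simp add: orthogonal_def)
  then show ?thesis
    by (simp add: w_def S_def L_def)
qed

context manifold_chart
begin

lemma has_derivative_imp_has_partial:
  assumes "((f \<circ> param c) has_derivative D) (at (coord c p))"
  shows "has_partial c i f p (D (axis i 1))"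
proof -
  have line: "((\<lambda>s. coord c p + s *\<^sub>R axis i 1) has_vector_derivative axis i 1) (at 0)"
    by (auto intro!: derivative_eq_intros)
  then show ?thesis
    unfolding has_partial_def
    using vector_derivative_diff_chain_within[of "\<lambda>s. coord c p + s *\<^sub>R axis i 1" "axis i 1" 0 UNIV
        "f \<circ> param c" D] assms by (auto simp: o_def intro: has_derivative_at_withinI)
qed

text \<open>\<open>immersion\<close> speaks of the Frechet derivative, the geometric quantities of
  \<open>partial\<close>; expanding w in the standard basis translates between them.\<close>

lemma frechet_derivative_eq_partial:
  fixes f :: "'m \<Rightarrow> 'b::real_normed_vector"
  assumes "(f \<circ> param c) differentiable (at (coord c p))"
  shows "frechet_derivative (f \<circ> param c) (at (coord c p)) w = (\<Sum>i\<in>UNIV. w $ i *\<^sub>R partial c i f p)"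
proof -
  let ?D = "frechet_derivative (f \<circ> param c) (at (coord c p))"
  have D: "((f \<circ> param c) has_derivative ?D) (at (coord c p))"
    using assms by (simp add: frechet_derivative_works)
  have "?D w = ?D (\<Sum>i\<in>UNIV. w $ i *\<^sub>R axis i 1)"
    using basis_expansion[of w] by (simp add: scalar_mult_eq_scaleR)
  also have "\<dots> = (\<Sum>i\<in>UNIV. w $ i *\<^sub>R ?D (axis i 1))"
    using has_derivative_linear[OF D] by (simp add: linear_sum linear_cmul)
  finally show ?thesis
    by (simp add: partial_eqI[OF has_derivative_imp_has_partial[OF D]])
qed

lemma open_coord_image:
  assumes "open B"
  shows "open (coord c ` (cdom c \<inter> B))"
proof -
  have "homeomorphism (cdom c) U (coord c) (param c)"
    using is_chart by (simp add: is_chart_def)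
  then have "openin (top_of_set U) (coord c ` (cdom c \<inter> B))"
    by (rule homeomorphism_imp_open_map) (simp add: assms openin_open_Int)
  then show ?thesis
    using open_U openin_open_trans by blast
qed

end

section \<open>Kinematics of a moving hypersurface in a chart, before the flow equation is
  imposed\<close>

locale hypersurface_chart = manifold_chart c
  for c :: "('m::topological_space, 'n::finite) chart" +
  fixes T :: ereal and F \<nu> :: "real \<Rightarrow> 'm \<Rightarrow> real ^ 'd::finite"
  assumes dim: "CARD('d) = CARD('n) + 1"
    and F: "chart_Ck 2 T c F" and \<nu>: "chart_Ck 1 T c \<nu>"
    and imm: "\<And>t p. t \<in> time_interval T \<Longrightarrow> p \<in> cdom c \<Longrightarrow>
      (F t \<circ> param c) differentiable (at (coord c p)) \<and>
      inj (frechet_derivative (F t \<circ> param c) (at (coord c p)))"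
    and norm_\<nu>: "\<And>t p. t \<in> time_interval T \<Longrightarrow> p \<in> cdom c \<Longrightarrow> norm (\<nu> t p) = 1"
    and \<nu>_normal: "\<And>t p i. t \<in> time_interval T \<Longrightarrow> p \<in> cdom c \<Longrightarrow> \<nu> t p \<bullet> partial c i (F t) p = 0"
begin

abbreviation V where "V \<equiv> time_deriv T F"
abbreviation I where "I \<equiv> time_interval T"
abbreviation ginv where "ginv \<equiv> inv_metric c F"
abbreviation S where "S \<equiv> S_form T c F"
abbreviation \<sigma> where "\<sigma> \<equiv> normal_speed T F \<nu>"
abbreviation H where "H \<equiv> mean_curvature c F \<nu>"
abbreviation div_S where "div_S t p \<equiv> ddagger c F t (S t) p"

lemma F_C2: "chart_Ck (Suc (Suc 0)) T c F"
  using F by (simp add: numeral_2_eq_2)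

lemma \<nu>_C1: "chart_Ck (Suc 0) T c \<nu>"
  using \<nu> by simp

lemma partials_independent:
  assumes "t \<in> I" "p \<in> cdom c" "(\<Sum>i\<in>UNIV. w $ i *\<^sub>R partial c i (F t) p) = 0"
  shows "w = 0"
proof -
  let ?D = "frechet_derivative (F t \<circ> param c) (at (coord c p))"
  have lin: "linear ?D" and inj: "inj ?D"
    using imm[OF assms(1,2)] by (auto intro: linear_frechet_derivative)
  have "?D w = 0"
    using assms imm[OF assms(1,2)] by (simp add: frechet_derivative_eq_partial)
  then show ?thesis
    using inj unfolding linear_injective_0[OF lin] by blast
qed

lemma det_metric_pos:
  assumes "t \<in> I" "p \<in> cdom c"
  shows "0 < det (metric c F t p)"
  unfolding metric_def
  using partials_independent[OF assms]
  by (intro det_pos_if_positive_definite gram_positive_definite) auto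

lemma metric_inv:
  assumes "t \<in> I" "p \<in> cdom c"
  shows "metric c F t p ** ginv t p = mat 1" "ginv t p ** metric c F t p = mat 1"
  using matrix_inv[of "metric c F t p"] det_metric_pos[OF assms]
  by (auto simp: inv_metric_def invertible_det_nz)

lemma ginv_commute:
  assumes "t \<in> I" "p \<in> cdom c"
  shows "ginv t p $ i $ j = ginv t p $ j $ i"
proof -
  have sym: "transpose (ginv t p) = ginv t p"
    unfolding inv_metric_def using det_metric_pos[OF assms]
    by (intro inv_symmetric_matrix)
      (auto simp: invertible_det_nz metric_def transpose_def vec_eq_iff inner_commute)
  have "ginv t p $ i $ j = transpose (ginv t p) $ j $ i"
    by (simp add: transpose_def)
  then show ?thesis
    by (simp only: sym)
qed

lemma velocity_decomposition:
  assumes "t \<in> I" "p \<in> cdom c"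
  shows "V t p = \<sigma> t p *\<^sub>R \<nu> t p + (\<Sum>k\<in>UNIV. S_up T c F t p $ k *\<^sub>R partial c k (F t) p)"
  using hypersurface_frame_decomposition[OF dim partials_independent[OF assms] norm_\<nu>[OF assms]
      \<nu>_normal[OF assms] metric_inv(1)[OF assms, unfolded metric_def], of "V t p"]
  by (simp add: normal_speed_def S_up_def S_form_def)

lemma S_up_expand: "S_up T c F t p $ k = (\<Sum>i\<in>UNIV. ginv t p $ k $ i * S t p $ i)"
  by (simp add: S_up_def matrix_vector_mult_def)

lemma S_norm_sq_eq: "S_norm_sq T c F t p = (\<Sum>k\<in>UNIV. S_up T c F t p $ k * S t p $ k)"
  by (simp add: S_norm_sq_def S_up_expand sum_distrib_left mult_ac)

lemma velocity_inner:
  assumes "t \<in> I" "p \<in> cdom c"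
  shows "V t p \<bullet> w = \<sigma> t p * (\<nu> t p \<bullet> w) + (\<Sum>k\<in>UNIV. S_up T c F t p $ k * (partial c k (F t) p \<bullet> w))"
  by (subst velocity_decomposition[OF assms]) (simp add: inner_add_left inner_sum_left)

lemma norm_velocity_sq:
  assumes "t \<in> I" "p \<in> cdom c"
  shows "(norm (V t p))\<^sup>2 = (\<sigma> t p)\<^sup>2 + S_norm_sq T c F t p"
  using velocity_inner[OF assms, of "V t p"] unfolding power2_norm_eq_inner
  by (simp add: S_norm_sq_eq S_form_def normal_speed_def inner_commute power2_eq_square)

lemma has_partial_F2: "t \<in> I \<Longrightarrow> p \<in> cdom c \<Longrightarrow>
    has_partial c i (partial c j (F t)) p (partial c i (partial c j (F t)) p)"
  by (rule has_partial_partial[OF chart_Ck_partial[OF F_C2]])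

lemma has_partial_V: "t \<in> I \<Longrightarrow> p \<in> cdom c \<Longrightarrow> has_partial c i (V t) p (partial c i (V t) p)"
  by (rule has_partial_partial[OF chart_Ck_time_deriv[OF F_C2]])

lemma has_partial_\<nu>: "t \<in> I \<Longrightarrow> p \<in> cdom c \<Longrightarrow> has_partial c i (\<nu> t) p (partial c i (\<nu> t) p)"
  by (rule has_partial_partial[OF \<nu>_C1])

lemma partial_metric:
  assumes "t \<in> I" "p \<in> cdom c"
  shows "partial c i (\<lambda>q. metric c F t q $ j $ l) p =
    partial c i (partial c j (F t)) p \<bullet> partial c l (F t) p +
    partial c j (F t) p \<bullet> partial c i (partial c l (F t)) p"
  using partial_eqI[OF has_partial_inner[OF assms(2) has_partial_F2[OF assms] has_partial_F2[OF assms]]]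
  by (simp add: metric_def add.commute)

text \<open>The product rule turns the three metric derivatives into six inner products. As second
  partials commute, four of them cancel and the remaining two agree, absorbing the factor
  1/2.\<close>

lemma christoffel_eq:
  assumes "t \<in> I" "p \<in> cdom c"
  shows "christoffel c F t k i j p =
    (\<Sum>l\<in>UNIV. ginv t p $ k $ l * (partial c i (partial c j (F t)) p \<bullet> partial c l (F t) p))"
proof -
  note comm = partial_commute[OF F_C2 assms]
  have "partial c i (\<lambda>q. metric c F t q $ j $ l) p + partial c j (\<lambda>q. metric c F t q $ i $ l) p
      - partial c l (\<lambda>q. metric c F t q $ i $ j) p =
      2 * (partial c i (partial c j (F t)) p \<bullet> partial c l (F t) p)" for l
    unfolding partial_metric[OF assms] comm[of l i] comm[of l j] comm[of j i]
    by (simp add: inner_commute)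
  then show ?thesis
    by (simp add: christoffel_def sum_distrib_left mult_ac)
qed

text \<open>Differentiating the relation that \<nu> is orthogonal to F_i moves the derivative from
  \<nu> to F_i.\<close>

lemma second_fundamental_form_eq:
  assumes "t \<in> I" "p \<in> cdom c"
  shows "second_fundamental_form c F \<nu> t p $ i $ j = \<nu> t p \<bullet> partial c j (partial c i (F t)) p"
proof -
  have "has_partial c j (\<lambda>q. \<nu> t q \<bullet> partial c i (F t) q) p
      (\<nu> t p \<bullet> partial c j (partial c i (F t)) p + partial c j (\<nu> t) p \<bullet> partial c i (F t) p)"
    by (rule has_partial_inner[OF assms(2) has_partial_\<nu>[OF assms] has_partial_F2[OF assms]])
  moreover have "partial c j (\<lambda>q. \<nu> t q \<bullet> partial c i (F t) q) p = 0"
    using assms by (intro partial_const) (auto simp: \<nu>_normal)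
  ultimately show ?thesis
    by (auto dest!: partial_eqI simp: second_fundamental_form_def inner_commute)
qed

lemma has_partial_S:
  assumes "t \<in> I" "p \<in> cdom c"
  shows "has_partial c i (\<lambda>q. S t q $ j) p
    (V t p \<bullet> partial c i (partial c j (F t)) p + partial c i (V t) p \<bullet> partial c j (F t) p)"
  using has_partial_inner[OF assms(2) has_partial_V[OF assms] has_partial_F2[OF assms]]
  by (simp add: S_form_def)

text \<open>The Gauss formula \<open>\<nabla>\<^sub>i F\<^sub>j = h\<^sub>i\<^sub>j \<nu>\<close>, tested against the velocity.\<close>

lemma cov_deriv_S:
  assumes "t \<in> I" "p \<in> cdom c"
  shows "cov_deriv c F t i j (S t) p =
    partial c i (V t) p \<bullet> partial c j (F t) p + \<sigma> t p * second_fundamental_form c F \<nu> t p $ j $ i"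
proof -
  have "(\<Sum>k\<in>UNIV. christoffel c F t k i j p * S t p $ k) =
      (\<Sum>k\<in>UNIV. \<Sum>l\<in>UNIV. ginv t p $ l $ k * S t p $ k *
        (partial c l (F t) p \<bullet> partial c i (partial c j (F t)) p))"
    by (simp add: christoffel_eq[OF assms] sum_distrib_left ginv_commute[OF assms] inner_commute mult_ac)
  also have "\<dots> = (\<Sum>l\<in>UNIV. S_up T c F t p $ l * (partial c l (F t) p \<bullet> partial c i (partial c j (F t)) p))"
    by (subst sum.swap) (simp add: S_up_expand sum_distrib_right)
  finally show ?thesis
    by (simp add: cov_deriv_def partial_eqI[OF has_partial_S[OF assms]] velocity_inner[OF assms]
        second_fundamental_form_eq[OF assms])
qed

text \<open>The trace of \<open>cov_deriv_S\<close>. Its first term is half the metric trace of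
  dg/dt, which is how the divergence enters the growth of the volume density.\<close>

lemma div_S_eq:
  assumes "t \<in> I" "p \<in> cdom c"
  shows "div_S t p = (\<Sum>i\<in>UNIV. \<Sum>j\<in>UNIV. ginv t p $ i $ j * (partial c j (V t) p \<bullet> partial c i (F t) p)) +
    \<sigma> t p * H t p"
  by (simp add: ddagger_def cov_deriv_S[OF assms] mean_curvature_def sum_distrib_left sum.distrib
      algebra_simps)

lemma has_partial_energy:
  assumes "t \<in> I" "p \<in> cdom c"
  shows "has_partial c i (energy T CARD('n) F t) p (V t p \<bullet> partial c i (V t) p)"
proof -
  have "has_partial c i (\<lambda>q. V t q \<bullet> V t q) p (V t p \<bullet> partial c i (V t) p + partial c i (V t) p \<bullet> V t p)"
    by (rule has_partial_inner[OF assms(2) has_partial_V[OF assms] has_partial_V[OF assms]])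
  then show ?thesis
    unfolding has_partial_def energy_def dot_square_norm[symmetric]
    by (auto intro!: derivative_eq_intros simp: has_real_derivative_iff_has_vector_derivative[symmetric]
        inner_commute)
qed

text \<open>Leibniz rule: the Christoffel terms are linear in the form, so only the partial
  derivative produces an extra term, whose trace pairs the differential of e with the raised
  S.\<close>

lemma ddagger_energy_S:
  assumes "t \<in> I" "p \<in> cdom c"
  shows "ddagger c F t (\<lambda>q. (real CARD('n) - energy T CARD('n) F t q) *\<^sub>R S t q) p =
    (real CARD('n) - energy T CARD('n) F t p) * div_S t p - (\<Sum>j\<in>UNIV. partial c j (energy T CARD('n) F t) p * S_up T c F t p $ j)"
proof -
  have cov: "cov_deriv c F t i j (\<lambda>q. (real CARD('n) - energy T CARD('n) F t q) *\<^sub>R S t q) p =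
      (real CARD('n) - energy T CARD('n) F t p) * cov_deriv c F t i j (S t) p - partial c i (energy T CARD('n) F t) p * S t p $ j" for i j
  proof -
    have "has_partial c i (\<lambda>q. real CARD('n) - energy T CARD('n) F t q) p (- partial c i (energy T CARD('n) F t) p)"
      using has_partial_energy[OF assms, of i] partial_eqI[OF has_partial_energy[OF assms, of i]]
      unfolding has_partial_def has_real_derivative_iff_has_vector_derivative[symmetric]
      by (auto intro!: derivative_eq_intros)
    from partial_eqI[OF has_partial_mult[OF assms(2) this has_partial_S[OF assms, of i j]]]
    show ?thesis
      by (simp add: cov_deriv_def partial_eqI[OF has_partial_S[OF assms]] sum_distrib_left algebra_simps)
  qed
  have "(\<Sum>i\<in>UNIV. \<Sum>j\<in>UNIV. ginv t p $ i $ j * (partial c j (energy T CARD('n) F t) p * S t p $ i)) =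
      (\<Sum>j\<in>UNIV. partial c j (energy T CARD('n) F t) p * S_up T c F t p $ j)"
    by (subst sum.swap) (simp add: S_up_expand sum_distrib_left ginv_commute[OF assms] mult_ac)
  then show ?thesis
    by (simp add: ddagger_def cov right_diff_distrib sum_subtractf sum_distrib_left mult_ac)
qed

lemma DERIV_metric:
  assumes "t \<in> I" "p \<in> cdom c"
  shows "((\<lambda>s. metric c F s p $ i $ j) has_real_derivative
    (partial c i (F t) p \<bullet> partial c j (V t) p + partial c i (V t) p \<bullet> partial c j (F t) p)) (at t within I)"
  using bounded_bilinear.has_vector_derivative[OF bounded_bilinear_inner
      partial_has_time_derivative[OF F_C2 assms, of i] partial_has_time_derivative[OF F_C2 assms, of j]]
  by (simp add: metric_def has_real_derivative_iff_has_vector_derivative)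

lemma DERIV_sqrt_det_metric:
  assumes "t \<in> I" "p \<in> cdom c"
  shows "((\<lambda>s. sqrt (det (metric c F s p))) has_real_derivative
    sqrt (det (metric c F t p)) * (div_S t p - \<sigma> t p * H t p)) (at t within I)"
proof -
  let ?g' = "(\<chi> i j. partial c i (F t) p \<bullet> partial c j (V t) p + partial c i (V t) p \<bullet> partial c j (F t) p)"
  let ?Q = "\<Sum>i\<in>UNIV. \<Sum>j\<in>UNIV. ginv t p $ i $ j * (partial c j (V t) p \<bullet> partial c i (F t) p)"
  have "((\<lambda>s. det (metric c F s p)) has_real_derivative
      det (metric c F t p) * (\<Sum>i\<in>UNIV. \<Sum>j\<in>UNIV. ?g' $ i $ j * ginv t p $ j $ i)) (at t within I)"
    using DERIV_metric[OF assms] metric_inv(2)[OF assms] by (intro det_has_derivative_Jacobi) auto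
  \<comment> \<open>The two summands of dg/dt are transposes of each other and have equal trace
    against the symmetric inverse metric. The resulting 2 cancels the 1/2 from the square
    root.\<close>
  moreover have "(\<Sum>i\<in>UNIV. \<Sum>j\<in>UNIV. ?g' $ i $ j * ginv t p $ j $ i) = 2 * ?Q"
  proof -
    have "(\<Sum>i\<in>UNIV. \<Sum>j\<in>UNIV. ginv t p $ j $ i * (partial c i (V t) p \<bullet> partial c j (F t) p)) = ?Q"
      by (rule sum.swap)
    then show ?thesis
      by (simp add: algebra_simps sum.distrib ginv_commute[OF assms] inner_commute)
  qed
  ultimately have "((\<lambda>s. det (metric c F s p)) has_real_derivative det (metric c F t p) * (2 * ?Q))
      (at t within I)"
    by simp
  from DERIV_chain2[OF DERIV_real_sqrt[OF det_metric_pos[OF assms]] this]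
  have "((\<lambda>s. sqrt (det (metric c F s p))) has_real_derivative
      inverse (sqrt (det (metric c F t p))) / 2 * (det (metric c F t p) * (2 * ?Q))) (at t within I)" .
  moreover have "inverse (sqrt (det (metric c F t p))) / 2 * (det (metric c F t p) * (2 * ?Q)) =
      sqrt (det (metric c F t p)) * ?Q"
    using det_metric_pos[OF assms] real_sqrt_mult_self[of "det (metric c F t p)"]
    by (simp add: field_simps del: real_sqrt_mult_self)
  moreover have "?Q = div_S t p - \<sigma> t p * H t p"
    by (simp add: div_S_eq[OF assms])
  ultimately show ?thesis
    by (simp only:)
qed

end

section \<open>The conservation law\<close>

context manifold_chart
begin

text \<open>One order is lost because velocity and metric are built from first derivatives of F. At
  time 0 this function is the coefficient of the conserved volume form.\<close>

lemma Ck_on_energy_density: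
  fixes F :: "real \<Rightarrow> 'm \<Rightarrow> real ^ 'd::finite"
  assumes F: "chart_Ck (Suc k) T c F" and T: "0 < T"
    and det: "\<And>p. p \<in> cdom c \<Longrightarrow> 0 < det (metric c F 0 p)"
  shows "Ck_on k U (\<lambda>x. energy T CARD('n) F 0 (param c x) * sqrt (det (metric c F 0 (param c x))))"
proof -
  \<comment> \<open>Restriction to time 0 is composition with the linear map x \<mapsto> (0, x),
    whose image lies on the boundary of the domain.\<close>
  have slice: "Ck_on k U (\<lambda>x. f 0 (param c x))" if "chart_Ck k T c f" for f :: "real \<Rightarrow> 'm \<Rightarrow> real"
    using Ck_on_compose_affine[of k "time_interval T \<times> U" "\<lambda>z. f (fst z) (param c (snd z))"
        "\<lambda>x. (0, x)" U "(0, 0)", OF _ bounded_linear_Pair[OF bounded_linear_zero bounded_linear_ident]]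
      that zero_in_time_interval[OF T]
    by (auto simp: chart_Ck_def)
  have metric: "chart_Ck k T c (\<lambda>t p. metric c F t p $ i $ j)" for i j
    using chart_Ck_inner[OF chart_Ck_partial[OF F] chart_Ck_partial[OF F]]
    by (simp add: metric_def)
  have "Ck_on k U (\<lambda>x. (1 / 2) * (time_deriv T F 0 (param c x) \<bullet> time_deriv T F 0 (param c x) + real CARD('n)))"
    by (intro Ck_on_mult Ck_on_add Ck_on_const slice[OF chart_Ck_inner] chart_Ck_time_deriv[OF F])
  moreover have "Ck_on k U (\<lambda>x. sqrt (det (metric c F 0 (param c x))))"
    by (intro Ck_on_sqrt Ck_on_det slice[OF metric] det param_in_cdom)
  ultimately show ?thesis
    unfolding energy_def power2_norm_eq_inner by (rule Ck_on_mult)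
qed

end

section \<open>Consequences of the flow equation in a chart\<close>

locale hmcf_chart = hypersurface_chart c T F \<nu>
  for c :: "('m::topological_space, 'n::finite) chart" and T :: ereal
    and F \<nu> :: "real \<Rightarrow> 'm \<Rightarrow> real ^ 'd::finite" +
  assumes flow: "\<And>t p. t \<in> I \<Longrightarrow> p \<in> cdom c \<Longrightarrow> time_deriv T V t p =
      ((energy T CARD('n) F t p - S_norm_sq T c F t p) * H t p - \<sigma> t p * div_S t p) *\<^sub>R \<nu> t p +
      (\<Sum>k\<in>UNIV. ((\<sigma> t p * H t p - div_S t p) * S_up T c F t p $ k -
        grad_up c F t k (energy T CARD('n) F t) p) *\<^sub>R partial c k (F t) p)"
begin

lemma DERIV_energy:
  assumes "t \<in> I" "p \<in> cdom c"
  shows "((\<lambda>s. energy T CARD('n) F s p) has_real_derivative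
    \<sigma> t p * energy T CARD('n) F t p * H t p - (2 * energy T CARD('n) F t p - real CARD('n)) * div_S t p
      - (\<Sum>j\<in>UNIV. partial c j (energy T CARD('n) F t) p * S_up T c F t p $ j)) (at t within I)"
proof -
  let ?e = "energy T CARD('n) F t"
  let ?V' = "time_deriv T V t p"
  let ?X = "\<Sum>j\<in>UNIV. partial c j ?e p * S_up T c F t p $ j"
  have V': "((\<lambda>s. V s p) has_vector_derivative ?V') (at t within I)"
    by (rule time_deriv_has_derivative[OF chart_Ck_time_deriv[OF F_C2] assms])
  have "((\<lambda>s. V s p \<bullet> V s p) has_real_derivative 2 * (V t p \<bullet> ?V')) (at t within I)"
    using bounded_bilinear.has_vector_derivative[OF bounded_bilinear_inner V' V']
    by (simp add: has_real_derivative_iff_has_vector_derivative inner_commute)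
  then have "((\<lambda>s. energy T CARD('n) F s p) has_real_derivative (V t p \<bullet> ?V')) (at t within I)"
    unfolding energy_def power2_norm_eq_inner by (auto intro!: derivative_eq_intros)
  moreover have "V t p \<bullet> ?V' = ((?e p - S_norm_sq T c F t p) * H t p - \<sigma> t p * div_S t p) * \<sigma> t p +
      (\<Sum>k\<in>UNIV. ((\<sigma> t p * H t p - div_S t p) * S_up T c F t p $ k - grad_up c F t k ?e p) * S t p $ k)"
    unfolding flow[OF assms]
    by (simp add: inner_add_right inner_sum_right normal_speed_def S_form_def)
  moreover have "(\<Sum>k\<in>UNIV. ((\<sigma> t p * H t p - div_S t p) * S_up T c F t p $ k - grad_up c F t k ?e p) * S t p $ k) =
      (\<sigma> t p * H t p - div_S t p) * S_norm_sq T c F t p - (\<Sum>k\<in>UNIV. grad_up c F t k ?e p * S t p $ k)"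
    unfolding left_diff_distrib sum_subtractf
    by (simp only: S_norm_sq_eq sum_distrib_left mult.assoc)
  moreover have "(\<Sum>k\<in>UNIV. grad_up c F t k ?e p * S t p $ k) = ?X"
  proof -
    have "(\<Sum>k\<in>UNIV. grad_up c F t k ?e p * S t p $ k) =
        (\<Sum>k\<in>UNIV. \<Sum>i\<in>UNIV. ginv t p $ i $ k * partial c i ?e p * S t p $ k)"
      by (simp add: grad_up_def sum_distrib_right ginv_commute[OF assms])
    also have "\<dots> = ?X"
      by (subst sum.swap) (simp add: S_up_expand sum_distrib_left mult_ac)
    finally show ?thesis .
  qed
  \<comment> \<open>The terms \<sigma> H |S|^2 from the normal and tangential parts cancel, and the
    divergence collects the factor \<sigma>^2 + |S|^2, which is 2e - n.\<close>
  moreover have "2 * ?e p - real CARD('n) = (\<sigma> t p)\<^sup>2 + S_norm_sq T c F t p"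
    by (simp add: energy_def norm_velocity_sq[OF assms] field_simps)
  ultimately show ?thesis
    by (simp only:) (simp add: algebra_simps power2_eq_square)
qed

text \<open>In the product rule the \<sigma> e H terms of the two factors cancel, and the divergence
  terms combine by -(2e - n) + e = n - e.\<close>

lemma energy_density_conservation_law:
  assumes "t \<in> I" "p \<in> cdom c"
  shows "((\<lambda>s. energy T CARD('n) F s p * sqrt (det (metric c F s p))) has_real_derivative
    ddagger c F t (\<lambda>q. (real CARD('n) - energy T CARD('n) F t q) *\<^sub>R S t q) p * sqrt (det (metric c F t p)))
    (at t within I)"
  unfolding ddagger_energy_S[OF assms]
  by (rule DERIV_cong[OF DERIV_mult[OF DERIV_energy[OF assms] DERIV_sqrt_det_metric[OF assms]]])
    (simp add: algebra_simps)

lemma S_density_conserved: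
  assumes "t \<in> I" "p \<in> cdom c"
  shows "((\<lambda>s. S s p $ i * sqrt (det (metric c F s p))) has_real_derivative 0) (at t within I)"
proof -
  let ?e = "energy T CARD('n) F t"
  let ?V' = "time_deriv T V t p"
  let ?a = "\<sigma> t p * H t p - div_S t p"
  have V': "((\<lambda>s. V s p) has_vector_derivative ?V') (at t within I)"
    by (rule time_deriv_has_derivative[OF chart_Ck_time_deriv[OF F_C2] assms])
  have S': "((\<lambda>s. S s p $ i) has_real_derivative
      V t p \<bullet> partial c i (V t) p + ?V' \<bullet> partial c i (F t) p) (at t within I)"
    using bounded_bilinear.has_vector_derivative[OF bounded_bilinear_inner V'
        partial_has_time_derivative[OF F_C2 assms, of i]]
    by (simp add: has_real_derivative_iff_has_vector_derivative S_form_def)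
  define w where "w = (\<chi> i. partial c i ?e p)"
  \<comment> \<open>Both tangential coefficients are raised covectors, so taking the inner product
    with F_i, which applies the metric, undoes the inverse metric.\<close>
  have B: "?a * S_up T c F t p $ k - grad_up c F t k ?e p = (ginv t p *v (?a *\<^sub>R S t p - w)) $ k" for k
    by (simp add: S_up_expand grad_up_def w_def matrix_vector_mult_def right_diff_distrib
        sum_subtractf sum_distrib_left mult_ac)
  have "?V' \<bullet> partial c i (F t) p =
      (\<Sum>k\<in>UNIV. metric c F t p $ i $ k * (ginv t p *v (?a *\<^sub>R S t p - w)) $ k)"
    unfolding flow[OF assms] B
    by (simp add: inner_add_left inner_sum_left \<nu>_normal[OF assms] metric_def
        inner_commute[of "partial c i (F t) p"] mult.commute)
  also have "\<dots> = (metric c F t p *v (ginv t p *v (?a *\<^sub>R S t p - w))) $ i"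
    by (simp add: matrix_vector_mult_def)
  also have "\<dots> = ?a * S t p $ i - partial c i ?e p"
    by (simp add: matrix_vector_mul_assoc metric_inv[OF assms] w_def)
  \<comment> \<open>The term from differentiating F_i in time is the partial derivative of e, which
    cancels the gradient term of the flow.\<close>
  finally have "V t p \<bullet> partial c i (V t) p + ?V' \<bullet> partial c i (F t) p = ?a * S t p $ i"
    by (simp add: partial_eqI[OF has_partial_energy[OF assms]])
  from S'[unfolded this] show ?thesis
    by (rule DERIV_cong[OF DERIV_mult[OF _ DERIV_sqrt_det_metric[OF assms]]]) (simp add: algebra_simps)
qed

lemma S_eq_0:
  assumes t: "t \<in> I" and p: "p \<in> cdom c" and S0: "S 0 p = 0"
  shows "S t p = 0"
proof -
  have "S t p $ i = 0" for i
  proof -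
    obtain k where k: "\<And>s. s \<in> I \<Longrightarrow> S s p $ i * sqrt (det (metric c F s p)) = k"
      using has_field_derivative_zero_constant[OF time_interval_convex S_density_conserved[OF _ p]]
      by blast
    have "0 \<in> I"
      using t le_less_trans[of "ereal 0" "ereal t" T] by (simp add: time_interval_def)
    from k[OF this] k[OF t] show ?thesis
      using det_metric_pos[OF t p] by (simp add: S0)
  qed
  then show ?thesis
    by (simp add: vec_eq_iff)
qed

text \<open>The divergence differentiates in space, so S must vanish on the whole chart domain and
  not just at p; \<open>S_eq_0\<close> propagates this from time 0 pointwise.\<close>

lemma ddagger_energy_S_eq_0:
  assumes t: "t \<in> I" and p: "p \<in> cdom c" and S0: "\<And>q. q \<in> cdom c \<Longrightarrow> S 0 q = 0"
  shows "ddagger c F t (\<lambda>q. (real CARD('n) - energy T CARD('n) F t q) *\<^sub>R S t q) p = 0"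
proof -
  have "cov_deriv c F t i j (\<lambda>q. (real CARD('n) - energy T CARD('n) F t q) *\<^sub>R S t q) p = 0" for i j
    using partial_const[OF p, of "\<lambda>q. ((real CARD('n) - energy T CARD('n) F t q) *\<^sub>R S t q) $ j" 0 i]
      S_eq_0[OF t _ S0] p
    by (simp add: cov_deriv_def)
  then show ?thesis
    by (simp add: ddagger_def)
qed

end

section \<open>Change of charts and well-definedness of the volume form\<close>

lemma partial_transition:
  fixes f :: "'m::topological_space \<Rightarrow> 'b::real_normed_vector"
    and c d :: "('m, 'n::finite) chart"
  assumes c: "is_chart c" and d: "is_chart d" and p: "p \<in> cdom c" "p \<in> cdom d"
    and J: "(transition c d has_derivative J) (at (coord c p))"
    and f: "(f \<circ> param d) differentiable (at (coord d p))"
  shows "partial c i f p = (\<Sum>j\<in>UNIV. matrix J $ j $ i *\<^sub>R partial d j f p)"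
proof -
  interpret c: manifold_chart c
    by unfold_locales (rule c)
  interpret d: manifold_chart d
    by unfold_locales (rule d)
  let ?D = "frechet_derivative (f \<circ> param d) (at (coord d p))"
  let ?W = "coord c ` (cdom c \<inter> cdom d)"
  have eq: "transition c d (coord c p) = coord d p"
    using p by (simp add: transition_def c.param_coord)
  have "((f \<circ> param d) has_derivative ?D) (at (transition c d (coord c p)))"
    using f unfolding eq by (simp add: frechet_derivative_works)
  from diff_chain_at[OF J this]
  have "((f \<circ> param d) \<circ> transition c d has_derivative ?D \<circ> J) (at (coord c p))" .
  moreover have "open ?W"
    using d by (intro c.open_coord_image) (simp add: is_chart_def)
  moreover have "coord c p \<in> ?W"
    using p by blast
  moreover have "((f \<circ> param d) \<circ> transition c d) x = (f \<circ> param c) x" if "x \<in> ?W" for x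
    using that by (auto simp: transition_def c.param_coord d.param_coord)
  ultimately have "(f \<circ> param c has_derivative ?D \<circ> J) (at (coord c p))"
    by (rule has_derivative_transform_within_open)
  from partial_eqI[OF c.has_derivative_imp_has_partial[OF this]]
  show ?thesis
    by (simp add: d.frechet_derivative_eq_partial[OF f] matrix_def)
qed

text \<open>\<open>frechet_derivative\<close> is chosen and carries information only where a
  derivative exists. The overlap has open coordinate image, so the derivative within it that
  smoothness provides is a full derivative.\<close>

lemma oriented_atlas_transition:
  fixes \<A> :: "('m::topological_space, 'n::finite) chart set"
  assumes M: "oriented_atlas \<A>" and c: "c \<in> \<A>" and d: "d \<in> \<A>" and p: "p \<in> cdom c" "p \<in> cdom d"
  shows "(transition c d has_derivative frechet_derivative (transition c d) (at (coord c p)))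
    (at (coord c p))"
proof -
  have charts: "is_chart c" "is_chart d"
    and smooth: "class_C_on \<infinity> (coord c ` (cdom c \<inter> cdom d)) (transition c d)"
    using M c d by (auto simp: oriented_atlas_def smooth_atlas_def)
  interpret c: manifold_chart c
    by unfold_locales (rule charts)
  let ?W = "coord c ` (cdom c \<inter> cdom d)"
  have W: "open ?W" "coord c p \<in> ?W"
    using charts(2) p by (auto intro!: c.open_coord_image simp: is_chart_def)
  have "Ck_on (Suc 0) ?W (transition c d)"
    using smooth by (rule class_C_on_imp_Ck_on) simp
  then obtain D where "\<And>x. x \<in> ?W \<Longrightarrow> (transition c d has_derivative D x) (at x within ?W)"
    by (rule Ck_on_SucE) blast
  with W have "(transition c d has_derivative D (coord c p)) (at (coord c p))"
    by (metis at_within_open)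
  then show ?thesis
    using frechet_derivative_works differentiableI by blast
qed

text \<open>With J the Jacobian matrix of the transition, the metric of c is J^T g J for g the
  metric of d. Thus its root determinant gains |det J|, equal to det J by orientation, while
  \<open>dx d\<close> is det J times \<open>dx c\<close>.\<close>

lemma volume_density_chart_independent:
  fixes \<A> :: "('m::topological_space, 'n::finite) chart set"
    and F :: "real \<Rightarrow> 'm \<Rightarrow> real ^ 'd::finite"
  assumes M: "oriented_atlas \<A>" and imm: "immersion \<A> (F t)"
    and c: "c \<in> \<A>" and d: "d \<in> \<A>" and p: "p \<in> cdom c" "p \<in> cdom d"
    and X: "\<And>i. X i \<in> tangent_space \<A> p"
  shows "sqrt (det (metric c F t p)) * dx c X = sqrt (det (metric d F t p)) * dx d X"
proof -
  let ?J = "frechet_derivative (transition c d) (at (coord c p))"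
  let ?M = "matrix ?J"
  have J: "(transition c d has_derivative ?J) (at (coord c p))"
    by (rule oriented_atlas_transition[OF M c d p])
  have charts: "is_chart c" "is_chart d" and pos: "0 < det ?M"
    using M c d p by (auto simp: oriented_atlas_def smooth_atlas_def)
  have f: "(F t \<circ> param d) differentiable (at (coord d p))"
    using imm d p by (simp add: immersion_def)
  have "metric c F t p = transpose ?M ** metric d F t p ** ?M"
  proof -
    have "metric c F t p $ i $ j = (transpose ?M ** metric d F t p ** ?M) $ i $ j" for i j
    proof -
      have "metric c F t p $ i $ j =
          (\<Sum>l\<in>UNIV. \<Sum>k\<in>UNIV. ?M $ k $ i * (?M $ l $ j * (partial d k (F t) p \<bullet> partial d l (F t) p)))"
        by (simp add: metric_def partial_transition[OF charts p J f] inner_sum_left inner_sum_right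
            sum_distrib_left mult_ac)
      then show ?thesis
        by (simp add: matrix_matrix_mult_def transpose_def metric_def sum_distrib_left
            sum_distrib_right mult_ac)
    qed
    then show ?thesis
      by (simp add: vec_eq_iff)
  qed
  then have "det (metric c F t p) = (det ?M)\<^sup>2 * det (metric d F t p)"
    by (simp add: det_mul det_transpose power2_eq_square)
  then have sq: "sqrt (det (metric c F t p)) = det ?M * sqrt (det (metric d F t p))"
    using pos by (simp add: real_sqrt_mult)
  have "X i d = ?J (X i c)" for i
    using X[of i] c d p unfolding tangent_space_def by blast
  then have "X i d = ?M *v X i c" for i
    using has_derivative_linear[OF J] by (simp only: matrix_works linear_matrix_vector_mul_eq)
  then have "dx d X = det ((\<chi> i. X i c) ** transpose ?M)"
    by (simp add: dx_def matrix_vector_mult_def matrix_matrix_mult_def transpose_def mult.commute)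
  then have "dx d X = det ?M * dx c X"
    by (simp add: det_mul det_transpose dx_def mult.commute)
  then show ?thesis
    by (simp add: sq)
qed

text \<open>The definite description in \<open>dmu\<close> is met by the value in any chart around
  p, by chart independence, and the chart c itself forces uniqueness.\<close>

lemma dmu_eq:
  fixes \<A> :: "('m::topological_space, 'n::finite) chart set"
    and F :: "real \<Rightarrow> 'm \<Rightarrow> real ^ 'd::finite"
  assumes "oriented_atlas \<A>" "immersion \<A> (F t)" "c \<in> \<A>" "p \<in> cdom c"
    and "\<And>i. X i \<in> tangent_space \<A> p"
  shows "dmu \<A> F t p X = sqrt (det (metric c F t p)) * dx c X"
  unfolding dmu_def
proof (rule the_equality)
  show "\<forall>d\<in>\<A>. p \<in> cdom d \<longrightarrow> sqrt (det (metric c F t p)) * dx c X = sqrt (det (metric d F t p)) * dx d X"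
    using volume_density_chart_independent[where F = F and t = t] assms by blast
qed (use assms in blast)

section \<open>Passage from charts to the manifold\<close>

theorem proposition4p6:
  fixes \<A> :: "('m::{t2_space, second_countable_topology}, 'n::finite) chart set"
    and F \<nu> :: "real \<Rightarrow> 'm \<Rightarrow> real ^ 'd::finite"
    and T :: ereal and r :: enat
  assumes dim: "CARD('d) = CARD('n) + 1"
    and M: "oriented_atlas \<A>"
    and T: "0 < T"
    and r: "2 \<le> r"
    and F: "class_C_family r T \<A> F"
    and imm: "\<And>t. t \<in> time_interval T \<Longrightarrow> immersion \<A> (F t)"
    and normal: "unit_normal_field T \<A> F \<nu>"
    and flow: "HMCF T \<A> F \<nu>"
  shows
    "(\<forall>t\<in>time_interval T. \<forall>c\<in>\<A>. \<forall>p\<in>cdom c. \<forall>X. (\<forall>i. X i \<in> tangent_space \<A> p) \<longrightarrow>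
        ((\<lambda>s. e_dmu T \<A> F s p X) has_real_derivative
           ddagger c F t (\<lambda>q. (real CARD('n) - energy T CARD('n) F t q) *\<^sub>R S_form T c F t q) p
             * dmu \<A> F t p X)
          (at t within time_interval T)) \<and>
     ((\<forall>c\<in>\<A>. \<forall>p\<in>cdom c. S_form T c F 0 p = 0) \<longrightarrow>
        (\<forall>t\<in>time_interval T. \<forall>p. \<forall>X. (\<forall>i. X i \<in> tangent_space \<A> p) \<longrightarrow>
           ((\<lambda>s. e_dmu T \<A> F s p X) has_real_derivative 0) (at t within time_interval T)) \<and>
        (\<exists>\<omega>. volume_form (r - 1) \<A> \<omega> \<and>
           (\<forall>t\<in>time_interval T. \<forall>p. \<forall>X. (\<forall>i. X i \<in> tangent_space \<A> p) \<longrightarrow>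
              e_dmu T \<A> F t p X = \<omega> p X)))"
proof -
  \<comment> \<open>Interpreting the chart locale later hides these two names behind locale
    facts.\<close>
  note immersion_F = imm and class_F = F
  have chart: "hmcf_chart c T F \<nu>" if c: "c \<in> \<A>" for c
  proof unfold_locales
    show "is_chart c"
      using M c by (simp add: oriented_atlas_def smooth_atlas_def)
    show "chart_Ck 2 T c F"
      by (rule class_C_family_imp_chart_Ck[OF F c]) (use r in \<open>simp add: numeral_eq_enat\<close>)
    show "chart_Ck 1 T c \<nu>"
      using normal c class_C_family_imp_chart_Ck[of 1 T \<A> \<nu> c 1]
      by (simp add: unit_normal_field_def one_enat_def)
    show "(F t \<circ> param c) differentiable (at (coord c p)) \<and>
        inj (frechet_derivative (F t \<circ> param c) (at (coord c p)))"
      if "t \<in> time_interval T" "p \<in> cdom c" for t p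
      using imm[OF that(1)] c that(2) by (simp add: immersion_def)
    show "norm (\<nu> t p) = 1" if "t \<in> time_interval T" "p \<in> cdom c" for t p
      using normal that by (simp add: unit_normal_field_def)
    show "\<nu> t p \<bullet> partial c i (F t) p = 0" if "t \<in> time_interval T" "p \<in> cdom c" for t p i
      using normal that c by (simp add: unit_normal_field_def)
    show "time_deriv T (time_deriv T F) t p =
        ((energy T CARD('n) F t p - S_norm_sq T c F t p) * mean_curvature c F \<nu> t p -
          normal_speed T F \<nu> t p * ddagger c F t (S_form T c F t) p) *\<^sub>R \<nu> t p +
        (\<Sum>k\<in>UNIV. ((normal_speed T F \<nu> t p * mean_curvature c F \<nu> t p - ddagger c F t (S_form T c F t) p) *
          S_up T c F t p $ k - grad_up c F t k (energy T CARD('n) F t) p) *\<^sub>R partial c k (F t) p)"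
      if "t \<in> time_interval T" "p \<in> cdom c" for t p
      using flow that c by (simp add: HMCF_def Let_def)
  qed (rule dim)
  have density: "e_dmu T \<A> F s p X =
      energy T CARD('n) F s p * sqrt (det (metric c F s p)) * dx c X"
    if "s \<in> time_interval T" "c \<in> \<A>" "p \<in> cdom c" "\<forall>i. X i \<in> tangent_space \<A> p" for s c p X
    using dmu_eq[where F = F and t = s, OF M imm[OF that(1)] that(2,3)] that(4) by (simp add: e_dmu_def)
  have law: "((\<lambda>s. e_dmu T \<A> F s p X) has_real_derivative
      ddagger c F t (\<lambda>q. (real CARD('n) - energy T CARD('n) F t q) *\<^sub>R S_form T c F t q) p
        * dmu \<A> F t p X) (at t within time_interval T)"
    if t: "t \<in> time_interval T" and c: "c \<in> \<A>" and p: "p \<in> cdom c"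
      and X: "\<forall>i. X i \<in> tangent_space \<A> p" for t c p X
  proof -
    interpret hmcf_chart c T F \<nu>
      by (rule chart[OF c])
    show ?thesis
    \<comment> \<open>The radius 1 is arbitrary: the formula for the form holds at every time of the
      interval.\<close>
    proof (rule has_field_derivative_transform_within[OF _ zero_less_one t])
      show "((\<lambda>s. energy T CARD('n) F s p * sqrt (det (metric c F s p)) * dx c X) has_real_derivative
          ddagger c F t (\<lambda>q. (real CARD('n) - energy T CARD('n) F t q) *\<^sub>R S_form T c F t q) p
            * dmu \<A> F t p X) (at t within time_interval T)"
        using DERIV_cmult_right[OF energy_density_conservation_law[OF t p], of "dx c X"]
          dmu_eq[where F = F and t = t, OF M immersion_F[OF t] c p] X by (simp add: mult.assoc)
    qed (use density c p X in auto)
  qed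
  have cover: "\<exists>c\<in>\<A>. p \<in> cdom c" for p
    using M by (auto simp: oriented_atlas_def smooth_atlas_def)
  have normal_case: "(\<forall>t\<in>time_interval T. \<forall>p. \<forall>X. (\<forall>i. X i \<in> tangent_space \<A> p) \<longrightarrow>
         ((\<lambda>s. e_dmu T \<A> F s p X) has_real_derivative 0) (at t within time_interval T)) \<and>
      (\<exists>\<omega>. volume_form (r - 1) \<A> \<omega> \<and>
         (\<forall>t\<in>time_interval T. \<forall>p. \<forall>X. (\<forall>i. X i \<in> tangent_space \<A> p) \<longrightarrow>
            e_dmu T \<A> F t p X = \<omega> p X))"
    if S0: "\<forall>c\<in>\<A>. \<forall>p\<in>cdom c. S_form T c F 0 p = 0"
  proof
    have zero: "((\<lambda>s. e_dmu T \<A> F s p X) has_real_derivative 0) (at t within time_interval T)"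
      if t: "t \<in> time_interval T" and X: "\<forall>i. X i \<in> tangent_space \<A> p" for t p X
    proof -
      obtain c where c: "c \<in> \<A>" "p \<in> cdom c"
        using cover by blast
      interpret hmcf_chart c T F \<nu>
        by (rule chart[OF c(1)])
      have "ddagger c F t (\<lambda>q. (real CARD('n) - energy T CARD('n) F t q) *\<^sub>R S_form T c F t q) p = 0"
        using S0 c by (intro ddagger_energy_S_eq_0[OF t c(2)]) auto
      with law[OF t c X] show ?thesis
        by simp
    qed
    then show "\<forall>t\<in>time_interval T. \<forall>p. \<forall>X. (\<forall>i. X i \<in> tangent_space \<A> p) \<longrightarrow>
         ((\<lambda>s. e_dmu T \<A> F s p X) has_real_derivative 0) (at t within time_interval T)"
      by blast
    have "e_dmu T \<A> F t p X = e_dmu T \<A> F 0 p X"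
      if t: "t \<in> time_interval T" and X: "\<forall>i. X i \<in> tangent_space \<A> p" for t p X
    proof -
      obtain k where "\<And>s. s \<in> time_interval T \<Longrightarrow> e_dmu T \<A> F s p X = k"
        using has_field_derivative_zero_constant[OF time_interval_convex zero[OF _ X]] by blast
      with t zero_in_time_interval[OF T] show ?thesis
        by simp
    qed
    \<comment> \<open>The form at time 0 is the witness for the time-independent volume
      form.\<close>
    moreover have "volume_form (r - 1) \<A> (e_dmu T \<A> F 0)"
      unfolding volume_form_def
    proof (intro ballI exI conjI allI impI)
      fix c assume c: "c \<in> \<A>"
      interpret hmcf_chart c T F \<nu>
        by (rule chart[OF c])
      note 0 = zero_in_time_interval[OF T]
      let ?f = "\<lambda>x. energy T CARD('n) F 0 (param c x) * sqrt (det (metric c F 0 (param c x)))"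
      show "class_C_on (r - 1) U ?f"
        unfolding class_C_on_def
      proof (intro allI impI)
        fix k assume "enat k \<le> r - 1"
        \<comment> \<open>As r is at least 2 or infinite, the truncated subtraction in
          \<open>r - 1\<close> is a true one.\<close>
        then have "enat (Suc k) \<le> r"
          using r by (cases r) (auto simp: one_enat_def numeral_eq_enat)
        then show "Ck_on k U ?f"
          by (intro Ck_on_energy_density[OF class_C_family_imp_chart_Ck[OF class_F c] T] det_metric_pos 0)
      qed
      show "?f x \<noteq> 0" if "x \<in> U" for x
      proof -
        \<comment> \<open>The summand n/2 is positive because an index type has at least one
          element, so e is positive even where the velocity vanishes.\<close>
        have "0 < energy T CARD('n) F 0 (param c x)"
          by (simp add: energy_def add_nonneg_pos)
        then show ?thesis
          using det_metric_pos[OF 0 param_in_cdom[OF that]] by simp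
      qed
      show "e_dmu T \<A> F 0 p X = ?f (coord c p) * dx c X"
        if "p \<in> cdom c" "\<forall>i. X i \<in> tangent_space \<A> p" for p X
        using density[OF 0 c that] that(1) by (simp add: param_coord)
    qed
    ultimately show "\<exists>\<omega>. volume_form (r - 1) \<A> \<omega> \<and>
         (\<forall>t\<in>time_interval T. \<forall>p. \<forall>X. (\<forall>i. X i \<in> tangent_space \<A> p) \<longrightarrow>
            e_dmu T \<A> F t p X = \<omega> p X)"
      by blast
  qed
  show ?thesis
    using law normal_case by blast
qed

end
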